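(* For every $s\in\mathbb{C}$ with $\mathrm{Re}(s)\ge0$ such that $a^ns\notin\{\lambda_k,2\lambda_k:k=1,\ldots,N\}$ for all $n\ge0$, $$\tilde Z(s;\theta)=\sum_{n=0}^\infty\prod_{d=0}^{n-1}U(a^ds;\theta)\,\tilde K(a^ns;\theta)+\prod_{n=0}^\infty U(a^ns;\theta)\,\tilde\pi,\qquad\tilde Z(0;\theta)=\tilde\pi .$$
   Context: Let $E=\{1,\ldots,N\}$, $a\in(0,1)$, $\theta\in[-1,1]$. $(Y_n)_{n\ge0}$ is an irreducible discrete-time Markov chain on $E$ with transition matrix $P=(p_{i,j})$ and stationary distribution $\tilde\pi=(\pi_1,\ldots,\pi_N)^T$. The nonnegative process $W_n$ satisfies $W_{n+1}=[aW_n+S_n-A_{n+1}]^+$, $[x]^+=\max(0,x)$. Given $Y_n$, the triple $(A_{n+1},S_n,Y_{n+1})$ is independent of the past (in particular of $W_n$), and $$P(A_{n+1}\le x,S_n\le y,Y_{n+1}=j\mid Y_n=i)=p_{i,j}\,C_\theta^{FGM}(F_{S,i}(y),F_{A,j}(x)),\quad x,y\ge0,$$ where $C_\theta^{FGM}(u_1,u_2)=u_1u_2+\theta u_1u_2(1-u_1)(1-u_2)$ is the Farlie–Gumbel–Morgenstern copula, $F_{S,i}$ is a distribution function on $[0,\infty)$ with density $f_{S,i}$, and $F_{A,j}(x)=1-e^{-\lambda_jx}$, $\lambda_j>0$. Notation: $g_i(y)=f_{S,i}(y)(1-2F_{S,i}(y))$, $\beta_i^*(s)=\int_0^\infty e^{-sy}f_{S,i}(y)dy$,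 $g_i^*(s)=\int_0^\infty e^{-sy}g_i(y)dy$, $B^*(s)=\mathrm{diag}(\beta_1^*(s),\ldots,\beta_N^*(s))$, $G^*(s)=\mathrm{diag}(g_1^*(s),\ldots,g_N^*(s))$, $L_k(s)=\mathrm{diag}\big(\frac{k\lambda_1}{k\lambda_1-s},\ldots,\frac{k\lambda_N}{k\lambda_N-s}\big)$, $k=1,2$. For $\mathrm{Re}(s)\ge0$, $Z_i(s;\theta)=\lim_{n\to\infty}E(e^{-sW_n}1_{\{Y_n=i\}})$; it is assumed that these limits exist and are the transforms $E(e^{-sW}1_{\{Y=i\}})$ of a steady-state pair $(W,Y)$ with $W$ finite and $P(Y=i)=\pi_i$; $\tilde Z(s;\theta)=(Z_1(s;\theta),\ldots,Z_N(s;\theta))^T$. Further, $$U(s;\theta)=L_1(s)[P^TB^*(s)+\theta(I-L_2(s))P^TG^*(s)],\quad \tilde K(s;\theta)=(I-L_1(s))\tilde v^{(1)}+(I-L_2(s))\tilde v^{(2)},$$ with $\tilde v^{(k)}=(v_1^{(k)},\ldots,v_N^{(k)})^T$, $v_j^{(1)}=\sum_ip_{i,j}(\beta_i^*(\lambda_j)-\theta g_i^*(\lambda_j))Z_i(a\lambda_j;\theta)$, $v_j^{(2)}=\theta\sum_ip_{i,j}g_i^*(2\lambda_j)Z_i(2a\lambda_j;\theta)$. Matrix products are ordered with increasing index from left to right, empty products are the identity, and $\prod_{n=0}^\infty U(a^ns;\theta)\tilde\pi$ means $\lim_{n\to\infty}\prod_{m=0}^{n}U(a^ms;\theta)\tilde\pi$.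 *)

theory Defs
  imports "HOL-Probability.Probability"
begin

text \<open>
  The type \<open>'a ^ 'n ^ 'n\<close> carries a componentwise multiplication, so neither \<open>prod\<close> nor
  \<open>(^)\<close> is the matrix product or power; products are built with \<open>(**)\<close> instead, with the
  index increasing from left to right: \<open>mat_prod U n = U 0 ** U 1 ** \<dots> ** U (n - 1)\<close>.
\<close>

primrec mat_prod :: "(nat \<Rightarrow> 'a::semiring_1 ^ 'n ^ 'n) \<Rightarrow> nat \<Rightarrow> 'a ^ 'n ^ 'n" where
  "mat_prod U 0 = mat 1"
| "mat_prod U (Suc n) = mat_prod U n ** U n"

definition diag :: "('n \<Rightarrow> complex) \<Rightarrow> complex ^ 'n ^ 'n" where
  "diag d = (\<chi> i j. if i = j then d i else 0)"

definition cvec :: "real ^ 'n \<Rightarrow> complex ^ 'n" where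
  "cvec x = (\<chi> i. complex_of_real (x $ i))"

definition cmat :: "real ^ 'n ^ 'n \<Rightarrow> complex ^ 'n ^ 'n" where
  "cmat P = (\<chi> i j. complex_of_real (P $ i $ j))"

definition stochastic_matrix :: "real ^ 'n ^ 'n \<Rightarrow> bool" where
  "stochastic_matrix P \<longleftrightarrow> (\<forall>i j. 0 \<le> P $ i $ j) \<and> (\<forall>i. (\<Sum>j\<in>UNIV. P $ i $ j) = 1)"

definition irreducible_matrix :: "real ^ 'n ^ 'n \<Rightarrow> bool" where
  "irreducible_matrix P \<longleftrightarrow> (\<forall>i j. \<exists>n. 0 < mat_prod (\<lambda>_. P) n $ i $ j)"

definition stationary_distribution :: "real ^ 'n ^ 'n \<Rightarrow> real ^ 'n \<Rightarrow> bool" where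
  "stationary_distribution P \<pi> \<longleftrightarrow>
     (\<forall>i. 0 \<le> \<pi> $ i) \<and> (\<Sum>i\<in>UNIV. \<pi> $ i) = 1 \<and> \<pi> v* P = \<pi>"

definition markov_chain ::
    "'w measure \<Rightarrow> (nat \<Rightarrow> 'w \<Rightarrow> 'n::finite) \<Rightarrow> real ^ 'n ^ 'n \<Rightarrow> bool" where
  "markov_chain M Y P \<longleftrightarrow>
     (\<forall>n. Y n \<in> measurable M (count_space UNIV)) \<and>
     (\<forall>n c j. \<P>(\<omega> in M. \<forall>k\<le>n. Y k \<omega> = c k) > 0 \<longrightarrow>
        \<P>(\<omega> in M. Y (Suc n) \<omega> = j \<bar> \<forall>k\<le>n. Y k \<omega> = c k) = P $ c n $ j)"

definition density_on_nonneg :: "(real \<Rightarrow> real) \<Rightarrow> bool" where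
  "density_on_nonneg f \<longleftrightarrow>
     (\<forall>y\<ge>0. 0 \<le> f y) \<and> set_integrable lborel {0..} f \<and> (LBINT y:{0..}. f y) = 1"

definition df_of :: "(real \<Rightarrow> real) \<Rightarrow> real \<Rightarrow> real" where
  "df_of f y = (LBINT t:{0..y}. f t)"

definition exp_df :: "real \<Rightarrow> real \<Rightarrow> real" where
  "exp_df l x = 1 - exp (- l * x)"

definition C_FGM :: "real \<Rightarrow> real \<Rightarrow> real \<Rightarrow> real" where
  "C_FGM \<theta> u1 u2 = u1 * u2 + \<theta> * u1 * u2 * (1 - u1) * (1 - u2)"

text \<open>
  \<open>past M W A S Y n\<close> is the sigma-algebra generated by \<open>W\<close> and \<open>Y\<close> up to time \<open>n\<close> and by the
  variables \<open>A 1, \<dots>, A n\<close> and \<open>S 0, \<dots>, S (n - 1)\<close> used up to then; \<open>A 0\<close> plays no role.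
\<close>

definition past ::
    "'w measure \<Rightarrow> (nat \<Rightarrow> 'w \<Rightarrow> real) \<Rightarrow> (nat \<Rightarrow> 'w \<Rightarrow> real) \<Rightarrow> (nat \<Rightarrow> 'w \<Rightarrow> real)
      \<Rightarrow> (nat \<Rightarrow> 'w \<Rightarrow> 'n::finite) \<Rightarrow> nat \<Rightarrow> 'w set set" where
  "past M W A S Y n = sigma_sets (space M)
     ({W k -` B \<inter> space M | k B. k \<le> n \<and> B \<in> sets borel} \<union>
      {Y k -` C \<inter> space M | k C. k \<le> n} \<union>
      {A k -` B \<inter> space M | k B. 1 \<le> k \<and> k \<le> n \<and> B \<in> sets borel} \<union>
      {S k -` B \<inter> space M | k B. k < n \<and> B \<in> sets borel})"

definition triple_indep_past ::
    "'w measure \<Rightarrow> (nat \<Rightarrow> 'w \<Rightarrow> real) \<Rightarrow> (nat \<Rightarrow> 'w \<Rightarrow> real) \<Rightarrow> (nat \<Rightarrow> 'w \<Rightarrow> real)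
      \<Rightarrow> (nat \<Rightarrow> 'w \<Rightarrow> 'n::finite) \<Rightarrow> bool" where
  "triple_indep_past M W A S Y \<longleftrightarrow>
     (\<forall>n i. \<forall>H \<in> past M W A S Y n.
        \<forall>T \<in> sets (borel \<Otimes>\<^sub>M borel \<Otimes>\<^sub>M count_space UNIV).
        \<P>(\<omega> in M. Y n \<omega> = i) > 0 \<longrightarrow>
        \<P>(\<omega> in M. \<omega> \<in> H \<and> (A (Suc n) \<omega>, S n \<omega>, Y (Suc n) \<omega>) \<in> T \<bar> Y n \<omega> = i) =
          \<P>(\<omega> in M. \<omega> \<in> H \<bar> Y n \<omega> = i) *
          \<P>(\<omega> in M. (A (Suc n) \<omega>, S n \<omega>, Y (Suc n) \<omega>) \<in> T \<bar> Y n \<omega> = i))"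

definition fgm_law ::
    "'w measure \<Rightarrow> (nat \<Rightarrow> 'w \<Rightarrow> real) \<Rightarrow> (nat \<Rightarrow> 'w \<Rightarrow> real) \<Rightarrow> (nat \<Rightarrow> 'w \<Rightarrow> 'n::finite)
      \<Rightarrow> real ^ 'n ^ 'n \<Rightarrow> real \<Rightarrow> ('n \<Rightarrow> real) \<Rightarrow> ('n \<Rightarrow> real \<Rightarrow> real) \<Rightarrow> bool" where
  "fgm_law M A S Y P \<theta> lam fS \<longleftrightarrow>
     (\<forall>n i j. \<forall>x\<ge>0. \<forall>y\<ge>0. \<P>(\<omega> in M. Y n \<omega> = i) > 0 \<longrightarrow>
        \<P>(\<omega> in M. A (Suc n) \<omega> \<le> x \<and> S n \<omega> \<le> y \<and> Y (Suc n) \<omega> = j \<bar> Y n \<omega> = i) =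
          P $ i $ j * C_FGM \<theta> (df_of (fS i) y) (exp_df (lam j) x))"

definition partial_transform ::
    "'w measure \<Rightarrow> ('w \<Rightarrow> real) \<Rightarrow> ('w \<Rightarrow> 'n) \<Rightarrow> complex \<Rightarrow> 'n \<Rightarrow> complex" where
  "partial_transform M W Y s i =
     (LINT \<omega>|M. exp (- s * complex_of_real (W \<omega>)) * of_bool (Y \<omega> = i))"

definition laplace :: "(real \<Rightarrow> real) \<Rightarrow> complex \<Rightarrow> complex" where
  "laplace f s = (LBINT y:{0..}. exp (- s * complex_of_real y) * complex_of_real (f y))"

definition g_of :: "(real \<Rightarrow> real) \<Rightarrow> real \<Rightarrow> real" where
  "g_of f y = f y * (1 - 2 * df_of f y)"

definition B_mat :: "('n \<Rightarrow> real \<Rightarrow> real) \<Rightarrow> complex \<Rightarrow> complex ^ 'n ^ 'n" where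
  "B_mat fS s = diag (\<lambda>i. laplace (fS i) s)"

definition G_mat :: "('n \<Rightarrow> real \<Rightarrow> real) \<Rightarrow> complex \<Rightarrow> complex ^ 'n ^ 'n" where
  "G_mat fS s = diag (\<lambda>i. laplace (g_of (fS i)) s)"

definition L_mat :: "('n \<Rightarrow> real) \<Rightarrow> nat \<Rightarrow> complex \<Rightarrow> complex ^ 'n ^ 'n" where
  "L_mat lam k s = diag (\<lambda>i. of_real (of_nat k * lam i) / (of_real (of_nat k * lam i) - s))"

definition U_mat ::
    "real ^ 'n ^ 'n \<Rightarrow> real \<Rightarrow> ('n \<Rightarrow> real) \<Rightarrow> ('n \<Rightarrow> real \<Rightarrow> real) \<Rightarrow> complex
      \<Rightarrow> complex ^ 'n ^ 'n" where
  "U_mat P \<theta> lam fS s =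
     L_mat lam 1 s **
       (transpose (cmat P) ** B_mat fS s +
        \<theta> *\<^sub>R ((mat 1 - L_mat lam 2 s) ** transpose (cmat P) ** G_mat fS s))"

definition v1 ::
    "real ^ 'n ^ 'n \<Rightarrow> real \<Rightarrow> real \<Rightarrow> ('n \<Rightarrow> real) \<Rightarrow> ('n \<Rightarrow> real \<Rightarrow> real)
      \<Rightarrow> (complex \<Rightarrow> complex ^ 'n) \<Rightarrow> complex ^ 'n" where
  "v1 P a \<theta> lam fS Z = (\<chi> j. \<Sum>i\<in>UNIV. of_real (P $ i $ j) *
     (laplace (fS i) (of_real (lam j)) - of_real \<theta> * laplace (g_of (fS i)) (of_real (lam j))) *
     Z (of_real (a * lam j)) $ i)"

definition v2 ::
    "real ^ 'n ^ 'n \<Rightarrow> real \<Rightarrow> real \<Rightarrow> ('n \<Rightarrow> real) \<Rightarrow> ('n \<Rightarrow> real \<Rightarrow> real)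
      \<Rightarrow> (complex \<Rightarrow> complex ^ 'n) \<Rightarrow> complex ^ 'n" where
  "v2 P a \<theta> lam fS Z = (\<chi> j. of_real \<theta> * (\<Sum>i\<in>UNIV. of_real (P $ i $ j) *
     laplace (g_of (fS i)) (of_real (2 * lam j)) * Z (of_real (2 * a * lam j)) $ i))"

definition K_vec ::
    "real ^ 'n ^ 'n \<Rightarrow> real \<Rightarrow> real \<Rightarrow> ('n \<Rightarrow> real) \<Rightarrow> ('n \<Rightarrow> real \<Rightarrow> real)
      \<Rightarrow> (complex \<Rightarrow> complex ^ 'n) \<Rightarrow> complex \<Rightarrow> complex ^ 'n" where
  "K_vec P a \<theta> lam fS Z s =
     (mat 1 - L_mat lam 1 s) *v v1 P a \<theta> lam fS Z + (mat 1 - L_mat lam 2 s) *v v2 P a \<theta> lam fS Z"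

end

theory Submission
  imports Defs
begin

text \<open>
  The transform of the workload satisfies \<open>Z s = U s *v Z (a s) + K s\<close>, and the formula for \<open>Z\<close>
  is this equation iterated along \<open>s, a s, a\<^sup>2 s, \<dots> \<rightarrow> 0\<close>.

  The functional equation (\<open>transform_equation\<close>) comes from one step of the workload recursion.
  For an exponential density of rate \<open>l\<close> and a level \<open>u \<ge> 0\<close>, the transform of \<open>max 0 (u - A)\<close> is a
  combination of \<open>exp (- s u)\<close> and \<open>exp (- l u)\<close> (\<open>clearing_transform\<close>). Under the
  Farlie--Gumbel--Morgenstern copula the pair of interarrival and service time has the density
  \<open>e\<^sub>1(x) f(y) + \<theta> (e\<^sub>2(x) - e\<^sub>1(x)) g(y)\<close>, where \<open>e\<^sub>k\<close> is the exponential density of rate \<open>k l\<close> and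
  \<open>g = f (1 - 2 F)\<close>; this rests on \<open>\<integral> g = F (1 - F)\<close> and on the uniqueness of a law with given
  distribution function (\<open>fgm_measure_unique\<close>). Given the state, the pair is independent of the
  workload, so it can be integrated out (\<open>product_law_on_event\<close>, \<open>integral_fgm_measure\<close>). The
  result is an identity between the transforms at times \<open>n\<close> and \<open>n + 1\<close>, in which \<open>n\<close> tends to
  infinity.

  For the iteration, the entries of \<open>U (a ^ m s)\<close> are bounded by those of \<open>P\<close> transposed up to a
  factor \<open>exp (c a ^ m)\<close>. Transposed stochastic matrices do not increase the sum of the moduli of
  the entries of a vector, and \<open>\<Sum>m. a ^ m\<close> is finite, so all products of these matrices are bounded
  (\<open>norm_mat_prod_le\<close>). As \<open>K (a ^ n s)\<close> is of order \<open>a ^ n\<close>, the series converges absolutely, and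
  with the continuity of \<open>Z\<close> at 0, where \<open>Z 0\<close> is the law of the stationary state, the remainder
  may be replaced by the product applied to that law (\<open>linear_recursion_solution\<close>).
\<close>

section \<open>Linear recursions with bounded matrix products\<close>

text \<open>
  Unrolling the recursion \<open>n\<close> times leaves the remainder \<open>mat_prod U n *v z n\<close>, which converges
  because the partial sums do. Bounded products make \<open>mat_prod U n *v (z n - l)\<close> vanish, so the
  convergence of \<open>mat_prod U n *v l\<close> is inherited from the remainder, although the matrix
  products themselves may fail to converge.
\<close>

lemma linear_recursion_solution:
  fixes U :: "nat \<Rightarrow> complex ^ 'n ^ 'n" and z k :: "nat \<Rightarrow> complex ^ 'n"
  assumes rec: "\<And>m. z m = U m *v z (Suc m) + k m"
    and bnd: "\<And>n v. norm (mat_prod U n *v v) \<le> B * norm v"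
    and k: "summable (\<lambda>n. norm (k n))"
    and lim_z: "z \<longlonglongrightarrow> l"
  shows "summable (\<lambda>n. mat_prod U n *v k n)"
    and "convergent (\<lambda>n. mat_prod U (Suc n) *v l)"
    and "z 0 = (\<Sum>n. mat_prod U n *v k n) + lim (\<lambda>n. mat_prod U (Suc n) *v l)"
proof -
  show sm: "summable (\<lambda>n. mat_prod U n *v k n)"
    by (rule summable_comparison_test'[OF summable_mult[OF k, of B], of 0]) (simp add: bnd)
  have unroll: "z 0 = (\<Sum>m<n. mat_prod U m *v k m) + mat_prod U n *v z n" for n
  proof (induction n)
    case (Suc n)
    have "mat_prod U n *v z n = mat_prod U n *v k n + mat_prod U (Suc n) *v z (Suc n)"
      by (subst rec) (simp add: matrix_vector_right_distrib matrix_vector_mul_assoc)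
    with Suc show ?case by simp
  qed simp
  have "(\<lambda>n. mat_prod U n *v z n) \<longlonglongrightarrow> z 0 - (\<Sum>n. mat_prod U n *v k n)"
  proof -
    have "(\<lambda>n. z 0 - (\<Sum>m<n. mat_prod U m *v k m)) \<longlonglongrightarrow> z 0 - (\<Sum>n. mat_prod U n *v k n)"
      by (intro tendsto_intros summable_LIMSEQ sm)
    moreover have "(\<lambda>n. z 0 - (\<Sum>m<n. mat_prod U m *v k m)) = (\<lambda>n. mat_prod U n *v z n)"
      using unroll by (auto simp: fun_eq_iff algebra_simps)
    ultimately show ?thesis by simp
  qed
  moreover have "(\<lambda>n. mat_prod U n *v (z n - l)) \<longlonglongrightarrow> 0"
  proof (rule Lim_null_comparison)
    show "\<forall>\<^sub>F n in sequentially. norm (mat_prod U n *v (z n - l)) \<le> B * norm (z n - l)"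
      by (simp add: bnd)
    show "(\<lambda>n. B * norm (z n - l)) \<longlonglongrightarrow> 0"
      using lim_z by (intro tendsto_mult_right_zero tendsto_norm_zero) (simp add: LIM_zero)
  qed
  ultimately have "(\<lambda>n. mat_prod U n *v z n - mat_prod U n *v (z n - l))
      \<longlonglongrightarrow> z 0 - (\<Sum>n. mat_prod U n *v k n) - 0"
    by (rule tendsto_diff)
  then have "(\<lambda>n. mat_prod U n *v l) \<longlonglongrightarrow> z 0 - (\<Sum>n. mat_prod U n *v k n)"
    by (simp add: matrix_vector_mult_diff_distrib)
  then have lim_l: "(\<lambda>n. mat_prod U (Suc n) *v l) \<longlonglongrightarrow> z 0 - (\<Sum>n. mat_prod U n *v k n)"
    by (rule LIMSEQ_Suc)
  then show "convergent (\<lambda>n. mat_prod U (Suc n) *v l)"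
    by (rule convergentI)
  show "z 0 = (\<Sum>n. mat_prod U n *v k n) + lim (\<lambda>n. mat_prod U (Suc n) *v l)"
    using limI[OF lim_l] by simp
qed

text \<open>
  In the norm that adds up the moduli of the entries, the transpose of a stochastic matrix has
  operator norm 1: its columns are the rows of \<open>P\<close>. A perturbation of each entry by a factor
  \<open>exp (c m)\<close> therefore costs only that factor, and products stay bounded as soon as the
  exponents are summable.
\<close>

lemma sum_norm_mat_prod_le:
  fixes U :: "nat \<Rightarrow> complex ^ 'n ^ 'n" and P :: "real ^ 'n ^ 'n"
  assumes rows: "\<And>i. (\<Sum>j\<in>UNIV. P $ i $ j) = 1"
    and U: "\<And>m i j. norm (U m $ j $ i) \<le> P $ i $ j * exp (c m)"
  shows "(\<Sum>j\<in>UNIV. norm ((mat_prod U n *v v) $ j)) \<le> exp (\<Sum>m<n. c m) * (\<Sum>j\<in>UNIV. norm (v $ j))"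
proof (induction n arbitrary: v)
  case (Suc n)
  have "(\<Sum>j\<in>UNIV. norm ((U n *v v) $ j)) \<le> (\<Sum>j\<in>UNIV. \<Sum>i\<in>UNIV. P $ i $ j * exp (c n) * norm (v $ i))"
  proof (rule sum_mono)
    fix j
    have "norm ((U n *v v) $ j) \<le> (\<Sum>i\<in>UNIV. norm (U n $ j $ i * v $ i))"
      unfolding matrix_vector_mult_def by (simp add: norm_sum)
    also have "\<dots> \<le> (\<Sum>i\<in>UNIV. P $ i $ j * exp (c n) * norm (v $ i))"
      by (intro sum_mono) (simp add: norm_mult U mult_right_mono)
    finally show "norm ((U n *v v) $ j) \<le> (\<Sum>i\<in>UNIV. P $ i $ j * exp (c n) * norm (v $ i))" .
  qed
  also have "\<dots> = (\<Sum>i\<in>UNIV. (\<Sum>j\<in>UNIV. P $ i $ j) * (exp (c n) * norm (v $ i)))"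
    by (subst sum.swap) (simp add: sum_distrib_right mult.assoc)
  also have "\<dots> = exp (c n) * (\<Sum>j\<in>UNIV. norm (v $ j))"
    by (simp add: rows sum_distrib_left)
  finally have step: "(\<Sum>j\<in>UNIV. norm ((U n *v v) $ j)) \<le> exp (c n) * (\<Sum>j\<in>UNIV. norm (v $ j))" .
  have "(\<Sum>j\<in>UNIV. norm ((mat_prod U (Suc n) *v v) $ j)) \<le>
      exp (\<Sum>m<n. c m) * (\<Sum>j\<in>UNIV. norm ((U n *v v) $ j))"
    using Suc[of "U n *v v"] by (simp add: matrix_vector_mul_assoc)
  also have "\<dots> \<le> exp (\<Sum>m<n. c m) * (exp (c n) * (\<Sum>j\<in>UNIV. norm (v $ j)))"
    by (intro mult_left_mono step) simp
  finally show ?case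
    by (simp add: exp_add mult_ac)
qed simp

lemma norm_mat_prod_le:
  fixes U :: "nat \<Rightarrow> complex ^ 'n ^ 'n" and P :: "real ^ 'n ^ 'n"
  assumes rows: "\<And>i. (\<Sum>j\<in>UNIV. P $ i $ j) = 1"
    and U: "\<And>m i j. norm (U m $ j $ i) \<le> P $ i $ j * exp (c m)"
    and c: "\<And>n. (\<Sum>m<n. c m) \<le> C"
  shows "norm (mat_prod U n *v v) \<le> exp C * real CARD('n) * norm v"
proof -
  have "norm (mat_prod U n *v v) \<le> (\<Sum>j\<in>UNIV. norm ((mat_prod U n *v v) $ j))"
    unfolding norm_vec_def by (rule L2_set_le_sum) simp
  also have "\<dots> \<le> exp (\<Sum>m<n. c m) * (\<Sum>j\<in>UNIV. norm (v $ j))"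
    by (rule sum_norm_mat_prod_le[OF rows U])
  also have "\<dots> \<le> exp C * (\<Sum>j\<in>(UNIV :: 'n set). norm v)"
    by (intro mult_mono sum_mono component_le_norm_cart sum_nonneg) (use c in \<open>auto simp: Finite_Cartesian_Product.norm_nth_le\<close>)
  finally show ?thesis by simp
qed

section \<open>Densities on the half-line\<close>

lemma integrable_lborel_prod_mult:
  fixes u v :: "real \<Rightarrow> real"
  assumes u: "integrable lborel u" and v: "integrable lborel v"
  shows "integrable (lborel \<Otimes>\<^sub>M lborel) (\<lambda>(x, y). u x * v y)"
proof (rule lborel_pair.Fubini_integrable)
  have [measurable]: "u \<in> borel_measurable borel" "v \<in> borel_measurable borel"
    using u v by auto
  show "(\<lambda>(x, y). u x * v y) \<in> borel_measurable (lborel \<Otimes>\<^sub>M lborel)" by measurable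
  show "integrable lborel (\<lambda>x. \<integral>y. norm (case (x, y) of (x, y) \<Rightarrow> u x * v y) \<partial>lborel)"
    using integrable_norm[OF u] by (simp add: abs_mult)
  show "AE x in lborel. integrable lborel (\<lambda>y. case (x, y) of (x, y) \<Rightarrow> u x * v y)"
    using v by simp
qed

lemma integrable_cut:
  fixes h :: "real \<Rightarrow> real"
  assumes "A \<in> sets borel" "integrable lborel h"
  shows "integrable lborel (\<lambda>t. indicator A t * h t)"
  using integrable_mult_indicator[of A lborel h] assms by simp

text \<open>
  This is \<open>(H\<^sup>2)' = 2 H H'\<close> for \<open>H t = \<integral>\<^sub>u\<^sub>\<le>\<^sub>t h u\<close>. As \<open>h\<close> is merely integrable, \<open>H\<close> may
  fail to be differentiable; instead, the square is cut along its diagonal into two triangles, which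
  contribute equally by symmetry.
\<close>

lemma integral_mult_cumulative_self:
  fixes h :: "real \<Rightarrow> real"
  assumes h: "integrable lborel h"
  shows "2 * (\<integral>t. h t * (\<integral>u. indicator {..t} u * h u \<partial>lborel) \<partial>lborel) = (\<integral>t. h t \<partial>lborel)\<^sup>2"
proof -
  have [measurable]: "h \<in> borel_measurable borel" using h by auto
  let ?q = "\<lambda>(t, u). indicator {..t} u * (h t * h u) :: real"
  have meas: "?q \<in> borel_measurable (lborel \<Otimes>\<^sub>M lborel)"
  proof -
    have "?q = (\<lambda>p. indicator {p. snd p \<le> fst p} p * (h (fst p) * h (snd p)))"
      by (auto simp: fun_eq_iff indicator_def)
    moreover have "{p :: real \<times> real. snd p \<le> fst p} \<in> sets (borel \<Otimes>\<^sub>M borel)"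
      unfolding borel_prod by (intro borel_closed closed_Collect_le continuous_intros)
    ultimately show ?thesis by simp
  qed
  have q: "integrable (lborel \<Otimes>\<^sub>M lborel) ?q"
    by (rule Bochner_Integration.integrable_bound[OF integrable_lborel_prod_mult[OF h h] meas])
       (auto simp: indicator_def)
  have cut: "integrable lborel (\<lambda>u. indicator {..t} u * h u)" "integrable lborel (\<lambda>u. indicator {t..} u * h u)" for t
    by (intro integrable_cut h; simp)+
  have int1: "integrable lborel (\<lambda>t. h t * (\<integral>u. indicator {..t} u * h u \<partial>lborel))"
    using lborel_pair.integrable_fst'[OF q] by (simp add: mult_ac)
  have int2: "integrable lborel (\<lambda>t. h t * (\<integral>u. indicator {t..} u * h u \<partial>lborel))"
    using lborel_pair.integrable_snd[of "\<lambda>t u. indicator {..t} u * (h t * h u)"] q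
    by (simp add: mult_ac indicator_def)
  have "(\<integral>t. h t * (\<integral>u. indicator {..t} u * h u \<partial>lborel) \<partial>lborel)
      = (\<integral>t. (\<integral>u. indicator {..t} u * (h t * h u) \<partial>lborel) \<partial>lborel)"
    by (simp add: mult_ac)
  also have "\<dots> = (\<integral>u. (\<integral>t. indicator {..t} u * (h t * h u) \<partial>lborel) \<partial>lborel)"
    using lborel_pair.Fubini_integral[of "\<lambda>t u. indicator {..t} u * (h t * h u)"] q by simp
  also have "\<dots> = (\<integral>t. h t * (\<integral>u. indicator {t..} u * h u \<partial>lborel) \<partial>lborel)"
    by (simp add: mult_ac indicator_def)
  finally have sym: "(\<integral>t. h t * (\<integral>u. indicator {..t} u * h u \<partial>lborel) \<partial>lborel)
      = (\<integral>t. h t * (\<integral>u. indicator {t..} u * h u \<partial>lborel) \<partial>lborel)" .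
  have split: "(\<integral>u. indicator {..t} u * h u \<partial>lborel) + (\<integral>u. indicator {t..} u * h u \<partial>lborel)
      = (\<integral>u. h u \<partial>lborel)" for t
  proof -
    have "(\<integral>u. indicator {..t} u * h u \<partial>lborel) + (\<integral>u. indicator {t..} u * h u \<partial>lborel)
        = (\<integral>u. indicator {..t} u * h u + indicator {t..} u * h u \<partial>lborel)"
      using cut by simp
    also have "\<dots> = (\<integral>u. h u \<partial>lborel)"
      by (rule integral_cong_AE) (use AE_lborel_singleton[of t] in \<open>auto simp: indicator_def\<close>)
    finally show ?thesis .
  qed
  have "2 * (\<integral>t. h t * (\<integral>u. indicator {..t} u * h u \<partial>lborel) \<partial>lborel)
      = (\<integral>t. h t * (\<integral>u. indicator {..t} u * h u \<partial>lborel) + h t * (\<integral>u. indicator {t..} u * h u \<partial>lborel) \<partial>lborel)"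
    using sym int1 int2 by simp
  also have "\<dots> = (\<integral>t. h t * (\<integral>u. h u \<partial>lborel) \<partial>lborel)"
    unfolding distrib_left[symmetric] split ..
  finally show ?thesis by (simp add: power2_eq_square)
qed

text \<open>
  Extending by zero turns integrals over the half-line into integrals over \<open>lborel\<close>;
  a density on the half-line may take any values at negative arguments.
\<close>

definition zero_ext :: "(real \<Rightarrow> real) \<Rightarrow> real \<Rightarrow> real" where
  "zero_ext f y = indicator {0..} y * f y"

definition zero_ext_g :: "(real \<Rightarrow> real) \<Rightarrow> real \<Rightarrow> real" where
  "zero_ext_g f y = zero_ext f y * (1 - 2 * df_of f y)"

lemma zero_ext_g_eq: "zero_ext_g f y = indicator {0..} y * g_of f y"
  by (simp add: zero_ext_g_def zero_ext_def g_of_def)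

lemma laplace_zero_ext: "laplace f s = (\<integral>y. exp (- s * of_real y) * of_real (zero_ext f y) \<partial>lborel)"
  unfolding laplace_def set_lebesgue_integral_def
  by (intro Bochner_Integration.integral_cong) (auto simp: zero_ext_def indicator_def)

lemma laplace_zero_ext_g: "laplace (g_of f) s = (\<integral>y. exp (- s * of_real y) * of_real (zero_ext_g f y) \<partial>lborel)"
  unfolding laplace_def set_lebesgue_integral_def
  by (intro Bochner_Integration.integral_cong) (auto simp: zero_ext_g_eq indicator_def)

lemma df_of_zero_ext: "df_of f y = (\<integral>t. indicator {..y} t * zero_ext f t \<partial>lborel)"
  unfolding df_of_def set_lebesgue_integral_def
  by (intro Bochner_Integration.integral_cong) (auto simp: zero_ext_def indicator_def)

lemma df_of_nonpos: "y \<le> 0 \<Longrightarrow> df_of f y = 0"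
proof -
  assume "y \<le> 0"
  then have "AE t in lborel. indicator {..y} t * zero_ext f t = 0"
    by (intro eventually_mono[OF AE_lborel_singleton[of "0::real"]]) (auto simp: zero_ext_def indicator_def)
  then show ?thesis
    unfolding df_of_zero_ext by (rule integral_eq_zero_AE)
qed

lemma integrable_exp_times:
  fixes d :: "real \<Rightarrow> real"
  assumes d: "integrable lborel d" and d0: "\<And>y. y < 0 \<Longrightarrow> d y = 0" and s: "0 \<le> Re s"
  shows "integrable lborel (\<lambda>y. exp (- s * of_real y) * complex_of_real (d y))"
proof (rule Bochner_Integration.integrable_bound[OF d])
  have [measurable]: "d \<in> borel_measurable borel" using d by auto
  show "(\<lambda>y. exp (- s * of_real y) * complex_of_real (d y)) \<in> borel_measurable lborel"
    by measurable
  have "norm (exp (- s * of_real y) * complex_of_real (d y)) \<le> norm (d y)" for y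
  proof (cases "y < 0")
    case False
    then have "exp (- (Re s * y)) \<le> 1" using s by simp
    then show ?thesis by (simp add: norm_mult mult_left_le_one_le)
  qed (simp add: d0)
  then show "AE y in lborel. norm (exp (- s * of_real y) * complex_of_real (d y)) \<le> norm (d y)"
    by simp
qed

context
  fixes f :: "real \<Rightarrow> real"
  assumes f: "density_on_nonneg f"
begin

lemma integrable_zero_ext: "integrable lborel (zero_ext f)"
  using f unfolding density_on_nonneg_def set_integrable_def zero_ext_def by simp

lemma measurable_zero_ext [measurable]: "zero_ext f \<in> borel_measurable borel"
  using integrable_zero_ext by auto

lemma zero_ext_nonneg: "0 \<le> zero_ext f y"
  using f by (simp add: density_on_nonneg_def zero_ext_def indicator_def)

lemma integral_zero_ext: "(\<integral>y. zero_ext f y \<partial>lborel) = 1"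
  using f unfolding density_on_nonneg_def set_lebesgue_integral_def zero_ext_def by simp

lemma integrable_cut_zero_ext: "integrable lborel (\<lambda>t. indicator {..y} t * zero_ext f t)"
  by (intro integrable_cut integrable_zero_ext) simp

lemma df_of_nonneg: "0 \<le> df_of f y"
  unfolding df_of_zero_ext using zero_ext_nonneg by simp

lemma df_of_mono: "mono (df_of f)"
  unfolding df_of_zero_ext
  by (intro monoI integral_mono integrable_cut_zero_ext) (auto simp: indicator_def zero_ext_nonneg)

lemma df_of_le_1: "df_of f y \<le> 1"
  unfolding df_of_zero_ext integral_zero_ext[symmetric]
  by (intro integral_mono integrable_cut_zero_ext integrable_zero_ext) (auto simp: indicator_def zero_ext_nonneg)

lemma measurable_zero_ext_g [measurable]: "zero_ext_g f \<in> borel_measurable borel"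
proof -
  have [measurable]: "df_of f \<in> borel_measurable borel"
    by (rule borel_measurable_mono[OF df_of_mono])
  show ?thesis unfolding zero_ext_g_def by measurable
qed

lemma abs_zero_ext_g_le: "\<bar>zero_ext_g f y\<bar> \<le> zero_ext f y"
proof -
  have "\<bar>1 - 2 * df_of f y\<bar> \<le> 1"
    using df_of_nonneg[of y] df_of_le_1[of y] by linarith
  then show ?thesis
    using zero_ext_nonneg[of y] by (simp add: zero_ext_g_def abs_mult mult_left_le)
qed

lemma integrable_zero_ext_g: "integrable lborel (zero_ext_g f)"
  by (rule Bochner_Integration.integrable_bound[OF integrable_zero_ext]) (use abs_zero_ext_g_le zero_ext_nonneg in auto)

text \<open>
  Almost everywhere, \<open>g\<close> is the derivative of \<open>F (1 - F)\<close>, the factor that the FGM copula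
  contributes on the side of the service times.
\<close>

lemma integral_cut_zero_ext_g:
  "(\<integral>t. indicator {..y} t * zero_ext_g f t \<partial>lborel) = df_of f y * (1 - df_of f y)"
proof -
  let ?h = "\<lambda>t. indicator {..y} t * zero_ext f t"
  have eq: "?h t * df_of f t = ?h t * (\<integral>u. indicator {..t} u * ?h u \<partial>lborel)" for t
  proof (cases "t \<le> y")
    case True
    then have "df_of f t = (\<integral>u. indicator {..t} u * ?h u \<partial>lborel)"
      unfolding df_of_zero_ext by (intro Bochner_Integration.integral_cong) (auto simp: indicator_def)
    then show ?thesis by simp
  qed simp
  have "integrable lborel (\<lambda>t. indicator {..y} t * zero_ext_g f t)"
    by (intro integrable_cut integrable_zero_ext_g) simp
  then have "integrable lborel (\<lambda>t. ?h t - indicator {..y} t * zero_ext_g f t)"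
    using integrable_cut_zero_ext by simp
  moreover have "?h t - indicator {..y} t * zero_ext_g f t = 2 * (?h t * df_of f t)" for t
    by (simp add: zero_ext_g_def algebra_simps)
  ultimately have int: "integrable lborel (\<lambda>t. 2 * (?h t * df_of f t))"
    by simp
  have "(\<integral>t. indicator {..y} t * zero_ext_g f t \<partial>lborel) = (\<integral>t. ?h t - 2 * (?h t * df_of f t) \<partial>lborel)"
    by (intro Bochner_Integration.integral_cong) (simp_all add: zero_ext_g_def algebra_simps)
  also have "\<dots> = df_of f y - 2 * (\<integral>t. ?h t * df_of f t \<partial>lborel)"
    using int integrable_cut_zero_ext by (simp add: df_of_zero_ext)
  also have "(\<integral>t. ?h t * df_of f t \<partial>lborel) = (\<integral>t. ?h t * (\<integral>u. indicator {..t} u * ?h u \<partial>lborel) \<partial>lborel)"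
    unfolding eq ..
  also have "2 * \<dots> = (df_of f y)\<^sup>2"
    using integral_mult_cumulative_self[OF integrable_cut_zero_ext[of y]] by (simp add: df_of_zero_ext)
  finally show ?thesis by (simp add: power2_eq_square algebra_simps)
qed

lemma integrable_laplace:
  assumes "0 \<le> Re s"
  shows "integrable lborel (\<lambda>y. exp (- s * of_real y) * complex_of_real (zero_ext f y))"
    and "integrable lborel (\<lambda>y. exp (- s * of_real y) * complex_of_real (zero_ext_g f y))"
  by (intro integrable_exp_times integrable_zero_ext integrable_zero_ext_g assms; simp add: zero_ext_g_def zero_ext_def)+

lemma norm_exp_zero_ext_le:
  assumes "0 \<le> Re s"
  shows "norm (exp (- s * of_real y) * complex_of_real (zero_ext f y)) \<le> zero_ext f y"
    and "norm (exp (- s * of_real y) * complex_of_real (zero_ext_g f y)) \<le> zero_ext f y"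
proof -
  have *: "norm (exp (- s * of_real y)) * zero_ext f y \<le> zero_ext f y"
  proof (cases "0 \<le> y")
    case True
    then have "exp (- (Re s * y)) \<le> 1" using assms by simp
    then show ?thesis using zero_ext_nonneg by (simp add: mult_left_le_one_le)
  qed (simp add: zero_ext_def)
  then show "norm (exp (- s * of_real y) * complex_of_real (zero_ext f y)) \<le> zero_ext f y"
    using zero_ext_nonneg by (simp add: norm_mult)
  have "norm (exp (- s * of_real y) * complex_of_real (zero_ext_g f y)) \<le> norm (exp (- s * of_real y)) * zero_ext f y"
    by (simp only: norm_mult norm_of_real) (intro mult_left_mono abs_zero_ext_g_le norm_ge_zero)
  with * show "norm (exp (- s * of_real y) * complex_of_real (zero_ext_g f y)) \<le> zero_ext f y"
    by linarith
qed

lemma norm_laplace_le_1: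
  assumes "0 \<le> Re s"
  shows "norm (laplace f s) \<le> 1" and "norm (laplace (g_of f) s) \<le> 1"
proof -
  show "norm (laplace f s) \<le> 1"
    unfolding laplace_zero_ext integral_zero_ext[symmetric]
    by (intro Bochner_Integration.integral_norm_bound_integral integrable_laplace integrable_zero_ext
          norm_exp_zero_ext_le assms)
  show "norm (laplace (g_of f) s) \<le> 1"
    unfolding laplace_zero_ext_g integral_zero_ext[symmetric]
    by (intro Bochner_Integration.integral_norm_bound_integral integrable_laplace integrable_zero_ext
          norm_exp_zero_ext_le assms)
qed

end

section \<open>Exponential interarrival times\<close>

lemma integrable_exponential_density:
  assumes "0 < l" shows "integrable lborel (exponential_density l)"
    and "(\<integral>x. exponential_density l x \<partial>lborel) = 1"
proof -
  have "(\<integral>\<^sup>+x. ennreal (exponential_density l x) \<partial>lborel) = ennreal 1"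
    using prob_space.emeasure_space_1[OF prob_space_exponential_density[OF assms]]
    by (simp add: emeasure_density)
  then have "has_bochner_integral lborel (exponential_density l) 1"
    by (intro has_bochner_integral_nn_integral) (use assms in auto)
  then show "integrable lborel (exponential_density l)" "(\<integral>x. exponential_density l x \<partial>lborel) = 1"
    by (auto simp: has_bochner_integral_iff)
qed

lemma integral_cut_exponential_density:
  assumes "0 < l"
  shows "(\<integral>x. indicator {..u} x * exponential_density l x \<partial>lborel) = exp_df l (max 0 u)"
proof -
  have "(\<integral>\<^sup>+x. ennreal (indicator {..u} x * exponential_density l x) \<partial>lborel)
      = (\<integral>\<^sup>+x. ennreal (exponential_density l x) * indicator {..u} x \<partial>lborel)"
    by (intro nn_integral_cong) (auto simp: indicator_def)
  also have "\<dots> = ennreal (erlang_CDF 0 l u)"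
    using nn_integral_erlang_density[OF assms] by simp
  also have "erlang_CDF 0 l u = exp_df l (max 0 u)"
    by (simp add: erlang_CDF_0 exp_df_def)
  finally have "has_bochner_integral lborel (\<lambda>x. indicator {..u} x * exponential_density l x) (exp_df l (max 0 u))"
    by (intro has_bochner_integral_nn_integral) (use assms in \<open>auto simp: exp_df_def\<close>)
  then show ?thesis by (rule has_bochner_integral_integral_eq)
qed

text \<open>
  A workload \<open>u\<close> is drained for an exponential time of rate \<open>l\<close> and stopped at 0. On \<open>{0..u}\<close> the
  integrand is an exponential with an explicit primitive; past \<open>u\<close> the transform is 1 and the
  tail of the exponential law remains. The result is a combination of \<open>exp (- s u)\<close> and
  \<open>exp (- l u)\<close>, which is why the values of \<open>Z\<close> at multiples of the rates enter the equation.
\<close>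

lemma clearing_transform:
  fixes s :: complex and l u :: real
  assumes l: "0 < l" and u: "0 \<le> u" and s: "s \<noteq> of_real l"
  shows "(\<integral>x. exp (- s * of_real (max 0 (u - x))) * of_real (exponential_density l x) \<partial>lborel)
     = of_real l / (of_real l - s) * exp (- s * of_real u)
       + (1 - of_real l / (of_real l - s)) * exp (- of_real l * of_real u)"
proof -
  let ?L = "of_real l :: complex"
  have nz: "?L - s \<noteq> 0" using s by simp
  let ?I = "\<lambda>x. exp (- s * of_real (max 0 (u - x))) * of_real (exponential_density l x)"
  let ?F = "\<lambda>x :: real. - (?L / (?L - s) * exp (- s * of_real u - (?L - s) * of_real x))"
  let ?f = "\<lambda>x :: real. ?L * exp (- s * of_real u - (?L - s) * of_real x)"
  have "has_bochner_integral lborel (\<lambda>x. indicator {0..u} x *\<^sub>R ?f x) (?F u - ?F 0)"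
  proof (rule has_bochner_integral_FTC_Icc[OF u])
    show "(?F has_vector_derivative ?f x) (at x within {0..u})" for x
    proof -
      have "((\<lambda>z. - (?L / c * exp (b - c * z))) has_field_derivative ?L * exp (b - c * of_real x)) (at (of_real x))"
        if "c \<noteq> 0" for b c
        using that by (auto intro!: derivative_eq_intros)
      from has_vector_derivative_real_field[OF this[OF nz]] show ?thesis .
    qed
    show "continuous_on {0..u} ?f" by (intro continuous_intros)
  qed
  moreover have "has_bochner_integral lborel
      (\<lambda>x. of_real (exponential_density l x - indicator {..u} x * exponential_density l x)) (exp (- ?L * of_real u))"
  proof -
    have "integrable lborel (\<lambda>x. indicator {..u} x * exponential_density l x)"
      by (intro integrable_cut integrable_exponential_density l) simp
    then have "has_bochner_integral lborel
        (\<lambda>x. exponential_density l x - indicator {..u} x * exponential_density l x) (1 - exp_df l (max 0 u))"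
      using integrable_exponential_density[OF l] integral_cut_exponential_density[OF l]
      by (auto simp: has_bochner_integral_iff)
    from has_bochner_integral_of_real[OF this, where 'a = complex] show ?thesis
      using u by (simp add: exp_df_def exp_of_real[symmetric])
  qed
  ultimately have "has_bochner_integral lborel
      (\<lambda>x. indicator {0..u} x *\<^sub>R ?f x + of_real (exponential_density l x - indicator {..u} x * exponential_density l x))
      (?F u - ?F 0 + exp (- ?L * of_real u))"
    by (rule has_bochner_integral_add)
  moreover have "indicator {0..u} x *\<^sub>R ?f x + of_real (exponential_density l x - indicator {..u} x * exponential_density l x) = ?I x" for x
  proof (cases "0 \<le> x \<and> x \<le> u")
    case True
    then show ?thesis
      by (simp add: exponential_density_def exp_of_real[symmetric] exp_add[symmetric] algebra_simps exp_diff)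
  qed (auto simp: exponential_density_def indicator_def)
  moreover have "?F u - ?F 0 + exp (- ?L * of_real u) = ?L / (?L - s) * exp (- s * of_real u)
       + (1 - ?L / (?L - s)) * exp (- ?L * of_real u)"
    by (simp add: algebra_simps)
  ultimately show ?thesis
    by (simp add: has_bochner_integral_integral_eq)
qed

section \<open>The Farlie--Gumbel--Morgenstern law\<close>

text \<open>
  The mixed derivative of \<open>C_FGM \<theta> (F y) (G x)\<close> for the exponential distribution function \<open>G\<close>
  of rate \<open>l\<close>. Since \<open>G (1 - G) = exp (- l x) - exp (- 2 l x)\<close>, the copula term is a difference of
  exponential densities of rates \<open>2 l\<close> and \<open>l\<close>. The first coordinate is the interarrival time,
  the second the service time.
\<close>

definition fgm_density :: "real \<Rightarrow> real \<Rightarrow> (real \<Rightarrow> real) \<Rightarrow> real \<times> real \<Rightarrow> real" where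
  "fgm_density \<theta> l f = (\<lambda>(x, y). exponential_density l x * zero_ext f y
     + \<theta> * ((exponential_density (2 * l) x - exponential_density l x) * zero_ext_g f y))"

definition fgm_measure :: "real \<Rightarrow> real \<Rightarrow> (real \<Rightarrow> real) \<Rightarrow> (real \<times> real) measure" where
  "fgm_measure \<theta> l f = density (lborel \<Otimes>\<^sub>M lborel) (\<lambda>z. ennreal (fgm_density \<theta> l f z))"

lemma sets_fgm_measure [measurable_cong]: "sets (fgm_measure \<theta> l f) = sets (borel \<Otimes>\<^sub>M borel)"
  by (simp add: fgm_measure_def cong: sets_pair_measure_cong)

lemma space_fgm_measure [simp]: "space (fgm_measure \<theta> l f) = UNIV"
  by (simp add: fgm_measure_def space_pair_measure)

context
  fixes \<theta> l :: real and f :: "real \<Rightarrow> real"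
  assumes \<theta>: "-1 \<le> \<theta>" "\<theta> \<le> 1" and l: "0 < l" and f: "density_on_nonneg f"
begin

text \<open>
  With \<open>p = 2 exp (- l x) - 1\<close> and \<open>q = 1 - 2 F y\<close>, both in \<open>[-1, 1]\<close>, the density is the product of
  the marginal densities and \<open>1 + \<theta> p q\<close>.
\<close>

lemma fgm_density_nonneg: "0 \<le> fgm_density \<theta> l f z"
proof -
  obtain x y where z: "z = (x, y)" by (cases z)
  show ?thesis
  proof (cases "x < 0")
    case False
    let ?p = "2 * exp (- x * l) - 1" and ?q = "1 - 2 * df_of f y"
    have "exp (- x * l) \<le> 1" using False l by simp
    then have "\<bar>?p\<bar> \<le> 1" by (simp add: abs_le_iff)
    moreover have "\<bar>?q\<bar> \<le> 1"
      using df_of_nonneg[OF f, of y] df_of_le_1[OF f, of y] by linarith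
    ultimately have "\<bar>\<theta> * (?p * ?q)\<bar> \<le> 1"
      using \<theta> unfolding abs_mult by (intro mult_le_one) auto
    then have "0 \<le> 1 + \<theta> * (?p * ?q)" by linarith
    then have "0 \<le> exponential_density l x * zero_ext f y * (1 + \<theta> * (?p * ?q))"
      using l zero_ext_nonneg[OF f, of y] by simp
    also have "\<dots> = fgm_density \<theta> l f z"
      using False unfolding z fgm_density_def exponential_density_def zero_ext_g_def
      by (simp add: mult.assoc exp_add[symmetric] algebra_simps)
    finally show ?thesis .
  qed (simp add: z fgm_density_def exponential_density_def)
qed

lemma measurable_fgm_density [measurable]:
  "fgm_density \<theta> l f \<in> borel_measurable (borel \<Otimes>\<^sub>M borel)"
proof -
  note [measurable] = measurable_zero_ext[OF f] measurable_zero_ext_g[OF f]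
  show ?thesis unfolding fgm_density_def by measurable
qed

lemma integrable_fgm_factors:
  assumes "A \<in> sets borel" "B \<in> sets borel"
  shows "integrable (lborel \<Otimes>\<^sub>M lborel) (\<lambda>(x, y). (indicator A x * exponential_density l x) * (indicator B y * zero_ext f y))"
    and "integrable (lborel \<Otimes>\<^sub>M lborel) (\<lambda>(x, y).
      (indicator A x * (exponential_density (2 * l) x - exponential_density l x)) * (indicator B y * zero_ext_g f y))"
  using l by (intro integrable_lborel_prod_mult integrable_cut assms Bochner_Integration.integrable_diff
      integrable_exponential_density integrable_zero_ext[OF f] integrable_zero_ext_g[OF f]; simp)+

lemma has_bochner_integral_fgm_density:
  assumes "A \<in> sets borel" "B \<in> sets borel"
  shows "has_bochner_integral (lborel \<Otimes>\<^sub>M lborel) (\<lambda>z. indicator (A \<times> B) z * fgm_density \<theta> l f z)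
    ((\<integral>x. indicator A x * exponential_density l x \<partial>lborel) * (\<integral>y. indicator B y * zero_ext f y \<partial>lborel)
     + \<theta> * (((\<integral>x. indicator A x * exponential_density (2 * l) x \<partial>lborel)
              - (\<integral>x. indicator A x * exponential_density l x \<partial>lborel))
            * (\<integral>y. indicator B y * zero_ext_g f y \<partial>lborel)))"
proof -
  have eq: "(\<lambda>z. indicator (A \<times> B) z * fgm_density \<theta> l f z) =
    (\<lambda>z. (case z of (x, y) \<Rightarrow> (indicator A x * exponential_density l x) * (indicator B y * zero_ext f y))
      + \<theta> * (case z of (x, y) \<Rightarrow> (indicator A x * (exponential_density (2 * l) x - exponential_density l x)) * (indicator B y * zero_ext_g f y)))"
    by (auto simp: fun_eq_iff fgm_density_def indicator_times split: prod.split) (auto simp: algebra_simps)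
  have "has_bochner_integral (lborel \<Otimes>\<^sub>M lborel)
     (\<lambda>(x, y). (indicator A x * exponential_density l x) * (indicator B y * zero_ext f y))
     ((\<integral>x. indicator A x * exponential_density l x \<partial>lborel) * (\<integral>y. indicator B y * zero_ext f y \<partial>lborel))"
    using integrable_fgm_factors(1)[OF assms]
      lborel_pair.integral_fst'[OF integrable_fgm_factors(1)[OF assms]]
    by (simp add: has_bochner_integral_iff)
  moreover have "has_bochner_integral (lborel \<Otimes>\<^sub>M lborel)
     (\<lambda>(x, y). (indicator A x * (exponential_density (2 * l) x - exponential_density l x)) * (indicator B y * zero_ext_g f y))
     ((\<integral>x. indicator A x * (exponential_density (2 * l) x - exponential_density l x) \<partial>lborel)
        * (\<integral>y. indicator B y * zero_ext_g f y \<partial>lborel))"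
    using integrable_fgm_factors(2)[OF assms]
      lborel_pair.integral_fst'[OF integrable_fgm_factors(2)[OF assms]]
    by (simp add: has_bochner_integral_iff)
  moreover have "(\<integral>x. indicator A x * (exponential_density (2 * l) x - exponential_density l x) \<partial>lborel)
      = (\<integral>x. indicator A x * exponential_density (2 * l) x \<partial>lborel)
              - (\<integral>x. indicator A x * exponential_density l x \<partial>lborel)"
    using l assms by (simp add: right_diff_distrib integrable_cut integrable_exponential_density)
  ultimately show ?thesis
    unfolding eq by (intro has_bochner_integral_add has_bochner_integral_mult_right) auto
qed

lemma emeasure_fgm_measure_Times:
  assumes "A \<in> sets borel" "B \<in> sets borel"
  shows "emeasure (fgm_measure \<theta> l f) (A \<times> B) = ennreal
    ((\<integral>x. indicator A x * exponential_density l x \<partial>lborel) * (\<integral>y. indicator B y * zero_ext f y \<partial>lborel)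
     + \<theta> * (((\<integral>x. indicator A x * exponential_density (2 * l) x \<partial>lborel)
              - (\<integral>x. indicator A x * exponential_density l x \<partial>lborel))
            * (\<integral>y. indicator B y * zero_ext_g f y \<partial>lborel)))" (is "_ = ennreal ?r")
proof -
  have "emeasure (fgm_measure \<theta> l f) (A \<times> B)
      = (\<integral>\<^sup>+z. ennreal (fgm_density \<theta> l f z) * indicator (A \<times> B) z \<partial>(lborel \<Otimes>\<^sub>M lborel))"
    unfolding fgm_measure_def using assms by (intro emeasure_density) auto
  also have "\<dots> = (\<integral>\<^sup>+z. ennreal (indicator (A \<times> B) z * fgm_density \<theta> l f z) \<partial>(lborel \<Otimes>\<^sub>M lborel))"
    by (intro nn_integral_cong) (auto simp: indicator_def)
  also have "\<dots> = ennreal ?r"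
    using has_bochner_integral_fgm_density[OF assms]
    by (subst nn_integral_eq_integral) (auto simp: has_bochner_integral_iff fgm_density_nonneg)
  finally show ?thesis .
qed

lemma emeasure_fgm_measure_atMost:
  "emeasure (fgm_measure \<theta> l f) ({..x} \<times> {..y}) = ennreal (C_FGM \<theta> (df_of f y) (exp_df l (max 0 x)))"
proof -
  let ?m = "max 0 x"
  have "exp_df (2 * l) ?m - exp_df l ?m = exp_df l ?m * (1 - exp_df l ?m)"
    by (simp add: exp_df_def algebra_simps exp_add[symmetric])
  then have "emeasure (fgm_measure \<theta> l f) ({..x} \<times> {..y}) = ennreal (exp_df l ?m * df_of f y
      + \<theta> * (exp_df l ?m * (1 - exp_df l ?m) * (df_of f y * (1 - df_of f y))))"
    using l by (subst emeasure_fgm_measure_Times)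
      (simp_all add: integral_cut_exponential_density df_of_zero_ext[symmetric] integral_cut_zero_ext_g[OF f])
  then show ?thesis
    by (simp add: C_FGM_def mult_ac)
qed

lemma prob_space_fgm_measure: "prob_space (fgm_measure \<theta> l f)"
proof (rule prob_spaceI)
  have "emeasure (fgm_measure \<theta> l f) (UNIV \<times> UNIV) = 1"
    using l by (subst emeasure_fgm_measure_Times)
      (simp_all add: integrable_exponential_density integral_zero_ext[OF f])
  then show "emeasure (fgm_measure \<theta> l f) (space (fgm_measure \<theta> l f)) = 1" by simp
qed

text \<open>
  Quadrants generate the Borel sets of the plane, so the distribution function determines the
  law. The values on the axes force \<open>A > 0\<close> and \<open>S > 0\<close> almost everywhere on \<open>E\<close>, which supplies the
  distribution function at negative arguments.
\<close>

lemma fgm_measure_unique: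
  assumes M: "finite_measure M" and [measurable]: "A \<in> borel_measurable M" "S \<in> borel_measurable M" "E \<in> sets M"
    and c: "0 \<le> c"
    and df: "\<And>x y. 0 \<le> x \<Longrightarrow> 0 \<le> y \<Longrightarrow>
      measure M {\<omega>\<in>E. A \<omega> \<le> x \<and> S \<omega> \<le> y} = c * C_FGM \<theta> (df_of f y) (exp_df l x)"
    and C: "C \<in> sets (borel \<Otimes>\<^sub>M borel)"
  shows "measure M {\<omega>\<in>E. (A \<omega>, S \<omega>) \<in> C} = c * measure (fgm_measure \<theta> l f) C"
proof -
  interpret finite_measure M by fact
  interpret Q: prob_space "fgm_measure \<theta> l f" by (rule prob_space_fgm_measure)
  let ?\<nu> = "distr (density M (indicator E)) (borel \<Otimes>\<^sub>M borel) (\<lambda>\<omega>. (A \<omega>, S \<omega>))"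
  let ?Q = "scale_measure (ennreal c) (fgm_measure \<theta> l f)"
  have em: "emeasure ?\<nu> D = ennreal (measure M {\<omega>\<in>E. (A \<omega>, S \<omega>) \<in> D})" if [measurable]: "D \<in> sets (borel \<Otimes>\<^sub>M borel)" for D
  proof -
    have "E \<inter> ((\<lambda>\<omega>. (A \<omega>, S \<omega>)) -` D \<inter> space M) = {\<omega>\<in>E. (A \<omega>, S \<omega>) \<in> D}"
      using sets.sets_into_space[of E M] by auto
    then show ?thesis
      by (simp add: emeasure_distr emeasure_restricted emeasure_eq_measure)
  qed
  have full_df: "measure M {\<omega>\<in>E. A \<omega> \<le> x \<and> S \<omega> \<le> y} = c * C_FGM \<theta> (df_of f y) (exp_df l (max 0 x))" for x y
  proof (cases "0 \<le> x \<and> 0 \<le> y")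
    case False
    have "measure M {\<omega>\<in>E. A \<omega> \<le> x \<and> S \<omega> \<le> y} \<le> measure M {\<omega>\<in>E. A \<omega> \<le> max 0 x \<and> S \<omega> \<le> max 0 y}"
      by (intro finite_measure_mono) auto
    also have "\<dots> = 0"
      using False by (subst df) (auto simp: df_of_nonpos exp_df_def C_FGM_def max_def)
    finally show ?thesis
      using False by (auto simp: measure_le_0_iff df_of_nonpos exp_df_def C_FGM_def max_def)
  qed (simp add: df)
  have "?\<nu> = ?Q"
  proof (rule measure_eqI_generator_eq)
    let ?E = "range (\<lambda>z :: real \<times> real. {..z})"
    show "Int_stable ?E"
    proof (rule Int_stableI)
      fix a b assume "a \<in> ?E" "b \<in> ?E"
      then obtain x y where "a = {..x}" "b = {..y}" by auto
      then have "a \<inter> b = {..inf x y}" by auto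
      then show "a \<inter> b \<in> ?E" by blast
    qed
    show "?E \<subseteq> Pow UNIV" by simp
    have "sets (borel \<Otimes>\<^sub>M borel :: (real \<times> real) measure) = sigma_sets UNIV ?E"
      unfolding borel_prod by (subst borel_eq_atMost) simp
    then show "sets ?\<nu> = sigma_sets UNIV ?E" "sets ?Q = sigma_sets UNIV ?E"
      by (simp_all add: sets_fgm_measure)
    show "emeasure ?\<nu> X = emeasure ?Q X" if "X \<in> ?E" for X
    proof -
      obtain x y where "X = {..(x, y)}" using \<open>X \<in> ?E\<close> by auto
      also have "{..(x, y)} = {..x} \<times> {..y}" by auto
      finally have X: "X = {..x} \<times> {..y}" .
      then have "emeasure ?\<nu> X = ennreal (c * C_FGM \<theta> (df_of f y) (exp_df l (max 0 x)))"
        by (simp add: em full_df)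
      then show ?thesis
        using c unfolding X by (simp add: emeasure_fgm_measure_atMost ennreal_mult')
    qed
    show "range (\<lambda>n. {..(real n, real n)}) \<subseteq> ?E" by auto
    show "(\<Union>n. {..(real n, real n)}) = UNIV"
    proof safe
      fix x y :: real
      obtain n where "max x y \<le> real n" using real_arch_simple by blast
      then show "(x, y) \<in> (\<Union>n. {..(real n, real n)})" by auto
    qed simp
    show "emeasure ?\<nu> {..(real n, real n)} \<noteq> \<infinity>" for n
    proof -
      have "{..(real n, real n)} = {..real n} \<times> {..real n}" by (auto simp: atMost_def)
      then show ?thesis by (simp add: em)
    qed
  qed
  then have "emeasure ?\<nu> C = emeasure ?Q C" by simp
  then show ?thesis
    using C c by (simp add: em Q.emeasure_eq_measure ennreal_mult'[symmetric])
qed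

text \<open>
  Integrating first over the interarrival time applies the clearing transform to the level
  \<open>b + y\<close> for the rates \<open>l\<close> and \<open>2 l\<close>; integrating over the service time then produces the Laplace
  transforms.
\<close>

lemma integral_fgm_measure:
  fixes s L1 L2 :: complex
  assumes b: "0 \<le> b" and s: "0 \<le> Re s" and s1: "s \<noteq> complex_of_real l" and s2: "s \<noteq> complex_of_real (2 * l)"
  defines "L1 \<equiv> complex_of_real l / (complex_of_real l - s)" and "L2 \<equiv> complex_of_real (2 * l) / (complex_of_real (2 * l) - s)"
  shows "(\<integral>z. exp (- s * complex_of_real (max 0 (b + snd z - fst z))) \<partial>fgm_measure \<theta> l f)
    = (L1 * laplace f s + complex_of_real \<theta> * (L2 - L1) * laplace (g_of f) s) * exp (- s * complex_of_real b)
      + (1 - L1) * (laplace f (complex_of_real l) - complex_of_real \<theta> * laplace (g_of f) (complex_of_real l)) * exp (- complex_of_real l * complex_of_real b)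
      + complex_of_real \<theta> * (1 - L2) * laplace (g_of f) (complex_of_real (2 * l)) * exp (- complex_of_real (2 * l) * complex_of_real b)"
proof -
  let ?\<phi> = "\<lambda>z :: real \<times> real. exp (- s * complex_of_real (max 0 (b + snd z - fst z)))"
  let ?e = "\<lambda>k x. complex_of_real (exponential_density k x)"
  have \<phi>_le: "norm (?\<phi> z) \<le> 1" for z
    using s by simp
  have \<phi>[measurable]: "?\<phi> \<in> borel_measurable (borel \<Otimes>\<^sub>M borel)" by measurable
  have int: "integrable (lborel \<Otimes>\<^sub>M lborel) (\<lambda>z. fgm_density \<theta> l f z *\<^sub>R ?\<phi> z)"
  proof (rule Bochner_Integration.integrable_bound)
    show "integrable (lborel \<Otimes>\<^sub>M lborel) (fgm_density \<theta> l f)"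
      using has_bochner_integral_fgm_density[of UNIV UNIV] by (simp add: has_bochner_integral_iff)
    show "AE z in lborel \<Otimes>\<^sub>M lborel. norm (fgm_density \<theta> l f z *\<^sub>R ?\<phi> z) \<le> norm (fgm_density \<theta> l f z)"
      using \<phi>_le by (intro AE_I2) (simp add: mult_left_le)
  qed measurable
  have int_e: "integrable lborel (\<lambda>x. ?\<phi> (x, y) * ?e k x)" if "0 < k" for k y
  proof (rule Bochner_Integration.integrable_bound[OF integrable_exponential_density(1)[OF that]])
    show "AE x in lborel. norm (?\<phi> (x, y) * ?e k x) \<le> norm (exponential_density k x)"
      unfolding norm_mult norm_of_real real_norm_def
      by (intro AE_I2 mult_left_le_one_le \<phi>_le) auto
  qed measurable
  \<comment> \<open>\<open>T y\<close> is the inner integral, sorted by the three exponentials in \<open>b\<close>.\<close>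
  define T where "T y = exp (- s * complex_of_real b) * (exp (- s * complex_of_real y) * (L1 * complex_of_real (zero_ext f y) + complex_of_real \<theta> * (L2 - L1) * complex_of_real (zero_ext_g f y)))
      + (1 - L1) * exp (- complex_of_real l * complex_of_real b) * (exp (- complex_of_real l * complex_of_real y) * (complex_of_real (zero_ext f y) - complex_of_real \<theta> * complex_of_real (zero_ext_g f y)))
      + complex_of_real \<theta> * (1 - L2) * exp (- complex_of_real (2 * l) * complex_of_real b) * (exp (- complex_of_real (2 * l) * complex_of_real y) * complex_of_real (zero_ext_g f y))" for y
  have inner: "(\<integral>x. fgm_density \<theta> l f (x, y) *\<^sub>R ?\<phi> (x, y) \<partial>lborel) = T y" for y
  proof (cases "y < 0")
    case True
    then show ?thesis by (simp add: T_def fgm_density_def zero_ext_g_def zero_ext_def)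
  next
    case False
    have I: "(\<integral>x. ?\<phi> (x, y) * ?e k x \<partial>lborel)
        = complex_of_real k / (complex_of_real k - s) * (exp (- s * complex_of_real b) * exp (- s * complex_of_real y))
          + (1 - complex_of_real k / (complex_of_real k - s)) * (exp (- complex_of_real k * complex_of_real b) * exp (- complex_of_real k * complex_of_real y))"
      if "0 < k" "s \<noteq> complex_of_real k" for k
      using clearing_transform[of k "b + y" s] that b False
      by (simp add: exp_add[symmetric] distrib_left)
    have I1: "(\<integral>x. ?\<phi> (x, y) * ?e l x \<partial>lborel) = L1 * (exp (- s * complex_of_real b) * exp (- s * complex_of_real y))
          + (1 - L1) * (exp (- complex_of_real l * complex_of_real b) * exp (- complex_of_real l * complex_of_real y))"
      unfolding L1_def by (rule I[OF l s1])
    have I2: "(\<integral>x. ?\<phi> (x, y) * ?e (2 * l) x \<partial>lborel) = L2 * (exp (- s * complex_of_real b) * exp (- s * complex_of_real y))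
          + (1 - L2) * (exp (- complex_of_real (2 * l) * complex_of_real b) * exp (- complex_of_real (2 * l) * complex_of_real y))"
      unfolding L2_def using l by (intro I s2) simp
    have "(\<integral>x. fgm_density \<theta> l f (x, y) *\<^sub>R ?\<phi> (x, y) \<partial>lborel)
       = (\<integral>x. complex_of_real (zero_ext f y) * (?\<phi> (x, y) * ?e l x)
           + complex_of_real \<theta> * complex_of_real (zero_ext_g f y) * (?\<phi> (x, y) * ?e (2 * l) x - ?\<phi> (x, y) * ?e l x) \<partial>lborel)"
      by (intro Bochner_Integration.integral_cong)
         (simp_all add: fgm_density_def scaleR_conv_of_real algebra_simps)
    also have "\<dots> = complex_of_real (zero_ext f y) * (\<integral>x. ?\<phi> (x, y) * ?e l x \<partial>lborel)
           + complex_of_real \<theta> * complex_of_real (zero_ext_g f y) * ((\<integral>x. ?\<phi> (x, y) * ?e (2 * l) x \<partial>lborel) - (\<integral>x. ?\<phi> (x, y) * ?e l x \<partial>lborel))"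
      using int_e[of l y] int_e[of "2 * l" y] l
      by (subst Bochner_Integration.integral_add)
         (auto intro!: integrable_mult_right Bochner_Integration.integrable_diff)
    also have "\<dots> = T y"
      unfolding I1 I2 T_def by algebra
    finally show ?thesis .
  qed
  have "(\<integral>z. ?\<phi> z \<partial>fgm_measure \<theta> l f) = (\<integral>z. fgm_density \<theta> l f z *\<^sub>R ?\<phi> z \<partial>(lborel \<Otimes>\<^sub>M lborel))"
    unfolding fgm_measure_def
    by (rule integral_density) (auto simp: fgm_density_nonneg)
  also have "\<dots> = (\<integral>y. (\<integral>x. fgm_density \<theta> l f (x, y) *\<^sub>R ?\<phi> (x, y) \<partial>lborel) \<partial>lborel)"
    using lborel_pair.integral_snd[of "\<lambda>x y. fgm_density \<theta> l f (x, y) *\<^sub>R ?\<phi> (x, y)"] int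
    by (simp add: case_prod_unfold)
  also have "\<dots> = (\<integral>y. T y \<partial>lborel)"
    by (simp only: inner)
  also have "\<dots> = (L1 * laplace f s + complex_of_real \<theta> * (L2 - L1) * laplace (g_of f) s) * exp (- s * complex_of_real b)
      + (1 - L1) * (laplace f (complex_of_real l) - complex_of_real \<theta> * laplace (g_of f) (complex_of_real l)) * exp (- complex_of_real l * complex_of_real b)
      + complex_of_real \<theta> * (1 - L2) * laplace (g_of f) (complex_of_real (2 * l)) * exp (- complex_of_real (2 * l) * complex_of_real b)"
  proof -
    define P where "P s y = exp (- s * complex_of_real y) * complex_of_real (zero_ext f y)" for s y
    define G where "G s y = exp (- s * complex_of_real y) * complex_of_real (zero_ext_g f y)" for s y
    have hP: "has_bochner_integral lborel (P s) (laplace f s)"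
      and hG: "has_bochner_integral lborel (G s) (laplace (g_of f) s)" if "0 \<le> Re s" for s
      using integrable_laplace[OF f that] laplace_zero_ext[of f s] laplace_zero_ext_g[of f s]
      unfolding P_def G_def by (simp_all only: has_bochner_integral_iff)
    have T: "T = (\<lambda>y. exp (- s * complex_of_real b) * (L1 * P s y + complex_of_real \<theta> * (L2 - L1) * G s y)
      + (1 - L1) * exp (- complex_of_real l * complex_of_real b) * (P (complex_of_real l) y - complex_of_real \<theta> * G (complex_of_real l) y)
      + complex_of_real \<theta> * (1 - L2) * exp (- complex_of_real (2 * l) * complex_of_real b) * G (complex_of_real (2 * l)) y)"
      by (simp add: fun_eq_iff T_def P_def G_def algebra_simps)
    have "has_bochner_integral lborel T
     (exp (- s * complex_of_real b) * (L1 * laplace f s + complex_of_real \<theta> * (L2 - L1) * laplace (g_of f) s)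
      + (1 - L1) * exp (- complex_of_real l * complex_of_real b) * (laplace f (complex_of_real l) - complex_of_real \<theta> * laplace (g_of f) (complex_of_real l))
      + complex_of_real \<theta> * (1 - L2) * exp (- complex_of_real (2 * l) * complex_of_real b) * laplace (g_of f) (complex_of_real (2 * l)))"
      unfolding T using l s
      by (intro has_bochner_integral_add has_bochner_integral_diff has_bochner_integral_mult_right hP hG) auto
    then show ?thesis
      by (simp add: has_bochner_integral_integral_eq mult_ac)
  qed
  finally show ?thesis .
qed

end

section \<open>One step of the workload recursion\<close>

text \<open>
  On \<open>E\<close> the variable \<open>W\<close> is independent of the event \<open>E'\<close> together with the pair \<open>(A, S)\<close>. The
  restricted joint law is therefore a product measure and Fubini's theorem integrates out the
  pair. Working with restricted instead of conditional measures covers events \<open>E\<close> of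
  probability 0.
\<close>

lemma product_law_on_event:
  fixes W A S :: "'w \<Rightarrow> real" and \<phi> :: "real \<times> real \<times> real \<Rightarrow> complex"
  assumes M: "prob_space M" and Q: "prob_space Q" and sets_Q: "sets Q = sets (borel \<Otimes>\<^sub>M borel)"
    and [measurable]: "W \<in> borel_measurable M" "A \<in> borel_measurable M" "S \<in> borel_measurable M"
      "E \<in> sets M" "E' \<in> sets M"
    and p: "0 \<le> p"
    and ind: "\<And>B C. B \<in> sets borel \<Longrightarrow> C \<in> sets (borel \<Otimes>\<^sub>M borel) \<Longrightarrow>
      measure M {\<omega> \<in> E \<inter> E'. W \<omega> \<in> B \<and> (A \<omega>, S \<omega>) \<in> C} = measure M {\<omega> \<in> E. W \<omega> \<in> B} * (p * measure Q C)"
    and \<phi>[measurable]: "\<phi> \<in> borel_measurable (borel \<Otimes>\<^sub>M (borel \<Otimes>\<^sub>M borel))"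
    and \<phi>_le: "\<And>z. norm (\<phi> z) \<le> 1"
  shows "(\<integral>\<omega>. indicator (E \<inter> E') \<omega> *\<^sub>R \<phi> (W \<omega>, A \<omega>, S \<omega>) \<partial>M)
    = of_real p * (\<integral>\<omega>. indicator E \<omega> *\<^sub>R (\<integral>z. \<phi> (W \<omega>, z) \<partial>Q) \<partial>M)"
proof -
  interpret M: prob_space M by fact
  interpret Q: prob_space Q by fact
  note [measurable_cong] = sets_Q
  have sub: "E \<subseteq> space M" "E' \<subseteq> space M" by (auto intro!: sets.sets_into_space)
  let ?\<mu> = "distr (density M (indicator E)) borel W"
  let ?J = "distr (density M (indicator (E \<inter> E'))) (borel \<Otimes>\<^sub>M (borel \<Otimes>\<^sub>M borel)) (\<lambda>\<omega>. (W \<omega>, A \<omega>, S \<omega>))"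
  have em_\<mu>: "emeasure ?\<mu> B = ennreal (measure M {\<omega>\<in>E. W \<omega> \<in> B})" if [measurable]: "B \<in> sets borel" for B
  proof -
    have "E \<inter> (W -` B \<inter> space M) = {\<omega>\<in>E. W \<omega> \<in> B}" using sub by auto
    then show ?thesis by (simp add: emeasure_distr emeasure_restricted M.emeasure_eq_measure)
  qed
  have em_J: "emeasure ?J D = ennreal (measure M {\<omega>\<in>E \<inter> E'. (W \<omega>, A \<omega>, S \<omega>) \<in> D})"
    if [measurable]: "D \<in> sets (borel \<Otimes>\<^sub>M (borel \<Otimes>\<^sub>M borel))" for D
  proof -
    have "(E \<inter> E') \<inter> ((\<lambda>\<omega>. (W \<omega>, A \<omega>, S \<omega>)) -` D \<inter> space M) = {\<omega>\<in>E \<inter> E'. (W \<omega>, A \<omega>, S \<omega>) \<in> D}"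
      using sub by auto
    then show ?thesis by (simp add: emeasure_distr emeasure_restricted M.emeasure_eq_measure)
  qed
  interpret mu: finite_measure ?\<mu>
    by (rule finite_measureI) (simp add: em_\<mu>)
  let ?Q = "density Q (\<lambda>_. ennreal p)"
  interpret Qp: finite_measure ?Q
    by (rule finite_measureI) (simp add: emeasure_density_const Q.emeasure_space_1)
  interpret pair: pair_sigma_finite ?\<mu> ?Q ..
  have "?\<mu> \<Otimes>\<^sub>M ?Q = ?J"
  proof (rule pair_measure_eqI)
    show "sigma_finite_measure ?\<mu>" "sigma_finite_measure ?Q"
      by (rule mu.sigma_finite_measure_axioms Qp.sigma_finite_measure_axioms)+
    show "sets (?\<mu> \<Otimes>\<^sub>M ?Q) = sets ?J"
      by (simp add: sets_Q cong: sets_pair_measure_cong)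
    fix B C assume "B \<in> sets ?\<mu>" "C \<in> sets ?Q"
    then have B[measurable]: "B \<in> sets borel" and C[measurable]: "C \<in> sets (borel \<Otimes>\<^sub>M borel)"
      by (simp_all add: sets_Q)
    show "emeasure ?\<mu> B * emeasure ?Q C = emeasure ?J (B \<times> C)"
      using ind[OF B C] p
      by (simp add: em_\<mu> em_J emeasure_density_const sets_Q Q.emeasure_eq_measure ennreal_mult')
  qed
  note product = this
  have restrict: "(\<integral>\<omega>. g \<omega> \<partial>density M (indicator F)) = (\<integral>\<omega>. indicator F \<omega> *\<^sub>R g \<omega> \<partial>M)"
    if "F \<in> sets M" "g \<in> borel_measurable M" for F and g :: "'w \<Rightarrow> complex"
    using integral_density[of g M "indicator F"] that by (simp add: ennreal_indicator)
  have inner[measurable]: "(\<lambda>w. \<integral>z. \<phi> (w, z) \<partial>Q) \<in> borel_measurable borel"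
    by (rule Q.borel_measurable_lebesgue_integral) measurable
  have "(\<integral>\<omega>. indicator (E \<inter> E') \<omega> *\<^sub>R \<phi> (W \<omega>, A \<omega>, S \<omega>) \<partial>M) = (\<integral>z. \<phi> z \<partial>?J)"
    by (subst integral_distr) (auto simp: restrict)
  also have "\<dots> = (\<integral>z. \<phi> z \<partial>(?\<mu> \<Otimes>\<^sub>M ?Q))"
    unfolding product ..
  also have "\<dots> = (\<integral>w. (\<integral>z. \<phi> (w, z) \<partial>?Q) \<partial>?\<mu>)"
  proof (rule pair.integral_fst'[symmetric])
    interpret J: finite_measure ?J
      by (rule finite_measureI) (use em_J[OF sets.top] in \<open>simp add: space_pair_measure\<close>)
    show "integrable (?\<mu> \<Otimes>\<^sub>M ?Q) \<phi>"
      unfolding product by (rule J.integrable_const_bound[of _ 1]) (simp_all add: \<phi>_le)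
  qed
  also have "\<dots> = (\<integral>w. of_real p * (\<integral>z. \<phi> (w, z) \<partial>Q) \<partial>?\<mu>)"
    using p by (simp add: integral_density scaleR_conv_of_real)
  also have "\<dots> = of_real p * (\<integral>\<omega>. indicator E \<omega> *\<^sub>R (\<integral>z. \<phi> (W \<omega>, z) \<partial>Q) \<partial>M)"
    by (subst integral_distr) (simp_all add: restrict)
  finally show ?thesis .
qed

lemma pred_state_eq:
  assumes "Y \<in> measurable M (count_space UNIV)"
  shows "Measurable.pred M (\<lambda>\<omega>. Y \<omega> = k)"
proof -
  have "Y -` {k} \<inter> space M \<in> sets M"
    by (rule measurable_sets[OF assms]) simp
  also have "Y -` {k} \<inter> space M = {\<omega>\<in>space M. Y \<omega> = k}" by auto
  finally show ?thesis by (simp add: pred_def)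
qed

text \<open>
  Conditional independence given the state, with denominators cleared. Both sides vanish when
  the state \<open>i\<close> has probability 0 at time \<open>n\<close>, where the conditional hypotheses say nothing.
\<close>

lemma fgm_law_independent_of_workload:
  fixes W A S :: "nat \<Rightarrow> 'w \<Rightarrow> real" and Y :: "nat \<Rightarrow> 'w \<Rightarrow> 'n::finite"
  assumes M: "prob_space M" and \<theta>: "-1 \<le> \<theta>" "\<theta> \<le> 1" and lam: "0 < lam j"
    and fS: "density_on_nonneg (fS i)" and P: "0 \<le> P $ i $ j"
    and [measurable]: "\<And>n. W n \<in> borel_measurable M" "\<And>n. A n \<in> borel_measurable M"
        "\<And>n. S n \<in> borel_measurable M" and Y: "\<And>n. Y n \<in> measurable M (count_space UNIV)"
    and indep: "triple_indep_past M W A S Y" and law: "fgm_law M A S Y P \<theta> lam fS"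
    and B: "B \<in> sets borel" and C: "C \<in> sets (borel \<Otimes>\<^sub>M borel)"
  shows "measure M {\<omega> \<in> {\<omega>\<in>space M. Y n \<omega> = i} \<inter> {\<omega>\<in>space M. Y (Suc n) \<omega> = j}.
            W n \<omega> \<in> B \<and> (A (Suc n) \<omega>, S n \<omega>) \<in> C}
    = measure M {\<omega> \<in> {\<omega>\<in>space M. Y n \<omega> = i}. W n \<omega> \<in> B} * (P $ i $ j * measure (fgm_measure \<theta> (lam j) (fS i)) C)"
proof -
  interpret prob_space M by fact
  let ?E = "{\<omega>\<in>space M. Y n \<omega> = i}" and ?E' = "{\<omega>\<in>space M. Y (Suc n) \<omega> = j}"
  let ?p = "P $ i $ j"
  have event: "{\<omega>\<in>space M. Y m \<omega> = k} \<in> sets M" for m k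
    using pred_state_eq[OF Y] by (simp add: pred_def)
  note [measurable] = B C
  show ?thesis
  proof (cases "prob ?E = 0")
    case True
    have zero: "prob X = 0" if "X \<subseteq> ?E" for X
      using finite_measure_mono[OF that event] True by (simp add: measure_le_0_iff)
    have "prob {\<omega> \<in> ?E \<inter> ?E'. W n \<omega> \<in> B \<and> (A (Suc n) \<omega>, S n \<omega>) \<in> C} = 0"
      by (rule zero) auto
    moreover have "prob {\<omega> \<in> ?E. W n \<omega> \<in> B} = 0"
      by (rule zero) auto
    ultimately show ?thesis by simp
  next
    case False
    then have pos: "0 < prob ?E" by (subst zero_less_measure_iff)
    have joint: "measure M {\<omega> \<in> ?E \<inter> ?E'. (A (Suc n) \<omega>, S n \<omega>) \<in> C}
        = (prob ?E * ?p) * measure (fgm_measure \<theta> (lam j) (fS i)) C"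
    proof (rule fgm_measure_unique[OF \<theta> lam fS finite_measure_axioms _ _ _ _ _ C])
      fix x y :: real assume xy: "0 \<le> x" "0 \<le> y"
      have "\<P>(\<omega> in M. A (Suc n) \<omega> \<le> x \<and> S n \<omega> \<le> y \<and> Y (Suc n) \<omega> = j \<bar> Y n \<omega> = i) =
          ?p * C_FGM \<theta> (df_of (fS i) y) (exp_df (lam j) x)"
        by (rule law[unfolded fgm_law_def, rule_format, OF xy pos])
      moreover have "{\<omega>\<in>space M. (A (Suc n) \<omega> \<le> x \<and> S n \<omega> \<le> y \<and> Y (Suc n) \<omega> = j) \<and> Y n \<omega> = i}
          = {\<omega> \<in> ?E \<inter> ?E'. A (Suc n) \<omega> \<le> x \<and> S n \<omega> \<le> y}"
        by auto
      ultimately show "measure M {\<omega> \<in> ?E \<inter> ?E'. A (Suc n) \<omega> \<le> x \<and> S n \<omega> \<le> y}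
          = prob ?E * ?p * C_FGM \<theta> (df_of (fS i) y) (exp_df (lam j) x)"
        using pos by (simp add: cond_prob_def field_simps)
    next
      show "?E \<inter> ?E' \<in> sets M" by (intro sets.Int event)
      show "0 \<le> prob ?E * ?p" using P by (intro mult_nonneg_nonneg measure_nonneg)
    qed (rule assms)+
    let ?H = "W n -` B \<inter> space M"
    let ?T = "{z \<in> space (borel \<Otimes>\<^sub>M borel \<Otimes>\<^sub>M count_space UNIV). (fst z, fst (snd z)) \<in> C \<and> snd (snd z) = j}"
    have H: "?H \<in> past M W A S Y n"
      unfolding past_def using B
      by (intro sigma_sets.Basic UnI1 CollectI exI[of _ n] exI[of _ B]) simp
    have T: "?T \<in> sets (borel \<Otimes>\<^sub>M borel \<Otimes>\<^sub>M count_space UNIV)"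
      by measurable
    have "\<P>(\<omega> in M. \<omega> \<in> ?H \<and> (A (Suc n) \<omega>, S n \<omega>, Y (Suc n) \<omega>) \<in> ?T \<bar> Y n \<omega> = i) =
          \<P>(\<omega> in M. \<omega> \<in> ?H \<bar> Y n \<omega> = i) *
          \<P>(\<omega> in M. (A (Suc n) \<omega>, S n \<omega>, Y (Suc n) \<omega>) \<in> ?T \<bar> Y n \<omega> = i)"
      by (rule indep[unfolded triple_indep_past_def, rule_format, OF H T pos])
    moreover have "{\<omega>\<in>space M. (\<omega> \<in> ?H \<and> (A (Suc n) \<omega>, S n \<omega>, Y (Suc n) \<omega>) \<in> ?T) \<and> Y n \<omega> = i}
        = {\<omega> \<in> ?E \<inter> ?E'. W n \<omega> \<in> B \<and> (A (Suc n) \<omega>, S n \<omega>) \<in> C}"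
      by (auto simp: space_pair_measure)
    moreover have "{\<omega>\<in>space M. (A (Suc n) \<omega>, S n \<omega>, Y (Suc n) \<omega>) \<in> ?T \<and> Y n \<omega> = i}
        = {\<omega> \<in> ?E \<inter> ?E'. (A (Suc n) \<omega>, S n \<omega>) \<in> C}"
      by (auto simp: space_pair_measure)
    moreover have "{\<omega>\<in>space M. \<omega> \<in> ?H \<and> Y n \<omega> = i} = {\<omega> \<in> ?E. W n \<omega> \<in> B}"
      by auto
    ultimately show ?thesis
      using pos joint unfolding cond_prob_def by (simp add: field_simps)
  qed
qed

lemma workload_step_on_event:
  fixes W A S :: "nat \<Rightarrow> 'w \<Rightarrow> real" and Y :: "nat \<Rightarrow> 'w \<Rightarrow> 'n::finite" and s L1 L2 :: complex
  assumes M: "prob_space M" and \<theta>: "-1 \<le> \<theta>" "\<theta> \<le> 1" and lam: "0 < lam j" and a: "0 < a"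
    and fS: "density_on_nonneg (fS i)" and P: "0 \<le> P $ i $ j"
    and meas[measurable]: "\<And>n. W n \<in> borel_measurable M" "\<And>n. A n \<in> borel_measurable M"
        "\<And>n. S n \<in> borel_measurable M" and Y: "\<And>n. Y n \<in> measurable M (count_space UNIV)"
    and W_nonneg: "AE \<omega> in M. 0 \<le> W n \<omega>"
    and indep: "triple_indep_past M W A S Y" and law: "fgm_law M A S Y P \<theta> lam fS"
    and s: "0 \<le> Re s" and s1: "s \<noteq> of_real (lam j)" and s2: "s \<noteq> of_real (2 * lam j)"
  defines "L1 \<equiv> of_real (lam j) / (of_real (lam j) - s)"
    and "L2 \<equiv> of_real (2 * lam j) / (of_real (2 * lam j) - s)"
  shows "(\<integral>\<omega>. of_bool (Y n \<omega> = i \<and> Y (Suc n) \<omega> = j)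
        * exp (- s * of_real (max 0 (a * W n \<omega> + S n \<omega> - A (Suc n) \<omega>))) \<partial>M)
    = of_real (P $ i $ j) *
      ((L1 * laplace (fS i) s + of_real \<theta> * (L2 - L1) * laplace (g_of (fS i)) s)
          * partial_transform M (W n) (Y n) (of_real a * s) i
        + (1 - L1) * (laplace (fS i) (of_real (lam j)) - of_real \<theta> * laplace (g_of (fS i)) (of_real (lam j)))
          * partial_transform M (W n) (Y n) (of_real (a * lam j)) i
        + of_real \<theta> * (1 - L2) * laplace (g_of (fS i)) (of_real (2 * lam j))
          * partial_transform M (W n) (Y n) (of_real (2 * a * lam j)) i)"
proof -
  interpret prob_space M by fact
  note [measurable] = pred_state_eq[OF Y]
  let ?E = "{\<omega>\<in>space M. Y n \<omega> = i}" and ?E' = "{\<omega>\<in>space M. Y (Suc n) \<omega> = j}"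
  let ?Q = "fgm_measure \<theta> (lam j) (fS i)"
  let ?c1 = "L1 * laplace (fS i) s + of_real \<theta> * (L2 - L1) * laplace (g_of (fS i)) s"
  let ?c2 = "(1 - L1) * (laplace (fS i) (of_real (lam j)) - of_real \<theta> * laplace (g_of (fS i)) (of_real (lam j)))"
  let ?c3 = "of_real \<theta> * (1 - L2) * laplace (g_of (fS i)) (of_real (2 * lam j))"
  define \<phi> :: "real \<times> real \<times> real \<Rightarrow> complex"
    where "\<phi> z = exp (- s * of_real (max 0 (a * fst z + snd (snd z) - fst (snd z))))" for z
  have \<phi>[measurable]: "\<phi> \<in> borel_measurable (borel \<Otimes>\<^sub>M (borel \<Otimes>\<^sub>M borel))"
    unfolding \<phi>_def by measurable
  have \<phi>_le: "norm (\<phi> z) \<le> 1" for z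
    using s by (simp add: \<phi>_def)
  have hpt: "has_bochner_integral M (\<lambda>\<omega>. exp (- r * of_real (W n \<omega>)) * of_bool (Y n \<omega> = i)) (partial_transform M (W n) (Y n) r i)"
    if "0 \<le> Re r" for r
  proof -
    have "integrable M (\<lambda>\<omega>. exp (- r * of_real (W n \<omega>)) * of_bool (Y n \<omega> = i))"
      by (rule integrable_const_bound[of _ 1])
         (use W_nonneg that in \<open>auto simp: norm_mult elim!: eventually_mono\<close>)
    then show ?thesis by (simp add: has_bochner_integral_iff partial_transform_def)
  qed
  have "(\<integral>\<omega>. of_bool (Y n \<omega> = i \<and> Y (Suc n) \<omega> = j)
        * exp (- s * of_real (max 0 (a * W n \<omega> + S n \<omega> - A (Suc n) \<omega>))) \<partial>M)
     = (\<integral>\<omega>. indicator (?E \<inter> ?E') \<omega> *\<^sub>R \<phi> (W n \<omega>, A (Suc n) \<omega>, S n \<omega>) \<partial>M)"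
    by (intro Bochner_Integration.integral_cong) (auto simp: \<phi>_def indicator_def)
  also have "\<dots> = of_real (P $ i $ j) * (\<integral>\<omega>. indicator ?E \<omega> *\<^sub>R (\<integral>z. \<phi> (W n \<omega>, z) \<partial>?Q) \<partial>M)"
  proof (rule product_law_on_event[OF M prob_space_fgm_measure[OF \<theta> lam fS] sets_fgm_measure _ _ _ _ _ P _ \<phi> \<phi>_le])
    show "measure M {\<omega> \<in> ?E \<inter> ?E'. W n \<omega> \<in> B \<and> (A (Suc n) \<omega>, S n \<omega>) \<in> C}
        = measure M {\<omega> \<in> ?E. W n \<omega> \<in> B} * (P $ i $ j * measure ?Q C)"
      if "B \<in> sets borel" "C \<in> sets (borel \<Otimes>\<^sub>M borel)" for B C
      by (rule fgm_law_independent_of_workload[where lam = lam and fS = fS, OF M \<theta> lam fS P meas Y indep law that])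
  qed measurable
  also have "(\<integral>\<omega>. indicator ?E \<omega> *\<^sub>R (\<integral>z. \<phi> (W n \<omega>, z) \<partial>?Q) \<partial>M)
     = (\<integral>\<omega>. ?c1 * (exp (- (of_real a * s) * of_real (W n \<omega>)) * of_bool (Y n \<omega> = i))
         + ?c2 * (exp (- of_real (a * lam j) * of_real (W n \<omega>)) * of_bool (Y n \<omega> = i))
         + ?c3 * (exp (- of_real (2 * a * lam j) * of_real (W n \<omega>)) * of_bool (Y n \<omega> = i)) \<partial>M)"
  proof (rule integral_cong_AE)
    note [measurable_cong] = sets_fgm_measure
    interpret Q: prob_space ?Q by (rule prob_space_fgm_measure[OF \<theta> lam fS])
    have [measurable]: "(\<lambda>w. \<integral>z. \<phi> (w, z) \<partial>?Q) \<in> borel_measurable borel"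
      by (rule Q.borel_measurable_lebesgue_integral) measurable
    show "(\<lambda>\<omega>. indicator ?E \<omega> *\<^sub>R (\<integral>z. \<phi> (W n \<omega>, z) \<partial>?Q)) \<in> borel_measurable M"
      by measurable
    show "AE \<omega> in M. indicator ?E \<omega> *\<^sub>R (\<integral>z. \<phi> (W n \<omega>, z) \<partial>?Q) =
        ?c1 * (exp (- (of_real a * s) * of_real (W n \<omega>)) * of_bool (Y n \<omega> = i))
         + ?c2 * (exp (- of_real (a * lam j) * of_real (W n \<omega>)) * of_bool (Y n \<omega> = i))
         + ?c3 * (exp (- of_real (2 * a * lam j) * of_real (W n \<omega>)) * of_bool (Y n \<omega> = i))"
      using W_nonneg AE_space
    proof eventually_elim
      case (elim \<omega>)
      then have "0 \<le> a * W n \<omega>" using a by simp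
      from integral_fgm_measure[OF \<theta> lam fS this s s1 s2]
      have "(\<integral>z. \<phi> (W n \<omega>, z) \<partial>?Q) = ?c1 * exp (- s * of_real (a * W n \<omega>))
         + ?c2 * exp (- of_real (lam j) * of_real (a * W n \<omega>))
         + ?c3 * exp (- of_real (2 * lam j) * of_real (a * W n \<omega>))"
        unfolding \<phi>_def L1_def L2_def fst_conv snd_conv .
      moreover have "- s * of_real (a * W n \<omega>) = - (of_real a * s) * of_real (W n \<omega>)"
        "- complex_of_real (lam j) * of_real (a * W n \<omega>) = - of_real (a * lam j) * of_real (W n \<omega>)"
        "- complex_of_real (2 * lam j) * of_real (a * W n \<omega>) = - of_real (2 * a * lam j) * of_real (W n \<omega>)"
        by simp_all
      ultimately have "(\<integral>z. \<phi> (W n \<omega>, z) \<partial>?Q) = ?c1 * exp (- (of_real a * s) * of_real (W n \<omega>))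
         + ?c2 * exp (- of_real (a * lam j) * of_real (W n \<omega>))
         + ?c3 * exp (- of_real (2 * a * lam j) * of_real (W n \<omega>))"
        by (simp only:)
      then show ?case using elim by (simp add: indicator_def)
    qed
  qed measurable
  also have "\<dots> = ?c1 * partial_transform M (W n) (Y n) (of_real a * s) i
        + ?c2 * partial_transform M (W n) (Y n) (of_real (a * lam j)) i
        + ?c3 * partial_transform M (W n) (Y n) (of_real (2 * a * lam j)) i"
    using a s lam by (intro has_bochner_integral_integral_eq has_bochner_integral_add has_bochner_integral_mult_right hpt) auto
  finally show ?thesis .
qed

lemma partial_transform_step:
  fixes W A S :: "nat \<Rightarrow> 'w \<Rightarrow> real" and Y :: "nat \<Rightarrow> 'w \<Rightarrow> 'n::finite"
  assumes M: "prob_space M"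
    and [measurable]: "\<And>n. W n \<in> borel_measurable M" "\<And>n. A n \<in> borel_measurable M"
        "\<And>n. S n \<in> borel_measurable M" and Y: "\<And>n. Y n \<in> measurable M (count_space UNIV)"
    and recursion: "AE \<omega> in M. W (Suc n) \<omega> = max 0 (a * W n \<omega> + S n \<omega> - A (Suc n) \<omega>)"
    and s: "0 \<le> Re s"
  shows "partial_transform M (W (Suc n)) (Y (Suc n)) s j
    = (\<Sum>i\<in>UNIV. \<integral>\<omega>. of_bool (Y n \<omega> = i \<and> Y (Suc n) \<omega> = j)
        * exp (- s * of_real (max 0 (a * W n \<omega> + S n \<omega> - A (Suc n) \<omega>))) \<partial>M)"
proof -
  interpret prob_space M by fact
  note [measurable] = pred_state_eq[OF Y]
  let ?e = "\<lambda>\<omega>. exp (- s * complex_of_real (max 0 (a * W n \<omega> + S n \<omega> - A (Suc n) \<omega>)))"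
  have "partial_transform M (W (Suc n)) (Y (Suc n)) s j
     = (\<integral>\<omega>. (\<Sum>i\<in>UNIV. of_bool (Y n \<omega> = i \<and> Y (Suc n) \<omega> = j) * ?e \<omega>) \<partial>M)"
    unfolding partial_transform_def
  proof (rule integral_cong_AE)
    show "AE \<omega> in M. exp (- s * of_real (W (Suc n) \<omega>)) * of_bool (Y (Suc n) \<omega> = j)
       = (\<Sum>i\<in>UNIV. of_bool (Y n \<omega> = i \<and> Y (Suc n) \<omega> = j) * ?e \<omega>)"
      using recursion
    proof eventually_elim
      case (elim \<omega>)
      have "(\<Sum>i\<in>UNIV. of_bool (Y n \<omega> = i \<and> Y (Suc n) \<omega> = j) * ?e \<omega>)
         = (\<Sum>i\<in>UNIV. if i = Y n \<omega> then of_bool (Y (Suc n) \<omega> = j) * ?e \<omega> else 0)"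
        by (intro sum.cong) auto
      then show ?case by (simp add: elim)
    qed
  qed measurable
  also have "\<dots> = (\<Sum>i\<in>UNIV. \<integral>\<omega>. of_bool (Y n \<omega> = i \<and> Y (Suc n) \<omega> = j) * ?e \<omega> \<partial>M)"
  proof (rule Bochner_Integration.integral_sum)
    show "integrable M (\<lambda>\<omega>. of_bool (Y n \<omega> = i \<and> Y (Suc n) \<omega> = j) * ?e \<omega>)" for i
      by (rule integrable_const_bound[of _ 1]) (use s in \<open>auto simp: norm_mult\<close>)
  qed
  finally show ?thesis .
qed

section \<open>The functional equation and its solution\<close>

lemma diag_mult_nth: "(diag d ** X) $ i $ j = d i * X $ i $ j"
  by (simp add: matrix_matrix_mult_def diag_def if_distrib[of "\<lambda>x. x * _"] cong: if_cong)

lemma mult_diag_nth: "(X ** diag d) $ i $ j = X $ i $ j * d j"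
  by (simp add: matrix_matrix_mult_def diag_def if_distrib[of "\<lambda>x. _ * x"] cong: if_cong)

lemma diag_mult_vec_nth: "(diag d *v v) $ i = d i * v $ i"
  by (simp add: matrix_vector_mult_def diag_def if_distrib[of "\<lambda>x. x * _"] cong: if_cong)

lemma one_minus_diag: "mat 1 - diag d = diag (\<lambda>i. 1 - d i)"
  by (simp add: vec_eq_iff diag_def mat_def)

text \<open>
  The factor \<open>P $ i $ j\<close> is kept in front, since the norm bound compares the matrix entrywise with
  \<open>P\<close> transposed.
\<close>

lemma U_mat_nth:
  "U_mat P \<theta> lam fS s $ j $ i = of_real (P $ i $ j) * (of_real (lam j) / (of_real (lam j) - s) *
     (laplace (fS i) s + of_real \<theta> * (1 - of_real (2 * lam j) / (of_real (2 * lam j) - s)) * laplace (g_of (fS i)) s))"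
  by (simp add: U_mat_def L_mat_def B_mat_def G_mat_def one_minus_diag diag_mult_nth mult_diag_nth
      transpose_def cmat_def scaleR_conv_of_real[where 'a = complex]) (simp add: distrib_left mult_ac)

lemma K_vec_nth:
  "K_vec P a \<theta> lam fS Z s $ j =
     (1 - of_real (lam j) / (of_real (lam j) - s)) * v1 P a \<theta> lam fS Z $ j
     + (1 - of_real (2 * lam j) / (of_real (2 * lam j) - s)) * v2 P a \<theta> lam fS Z $ j"
  by (simp add: K_vec_def L_mat_def one_minus_diag diag_mult_vec_nth)

text \<open>
  The one-step identities between the transforms at times \<open>n\<close> and \<open>n + 1\<close> pass to the limit, one
  component and one predecessor state at a time.
\<close>

lemma transform_equation:
  fixes M :: "'w measure" and W A S :: "nat \<Rightarrow> 'w \<Rightarrow> real" and Y :: "nat \<Rightarrow> 'w \<Rightarrow> 'n::finite"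
    and Z :: "complex \<Rightarrow> complex ^ 'n"
  assumes M: "prob_space M" and \<theta>: "-1 \<le> \<theta>" "\<theta> \<le> 1" and a: "0 < a" and lam: "\<And>j. 0 < lam j"
    and fS: "\<And>i. density_on_nonneg (fS i)" and P: "\<And>i j. 0 \<le> P $ i $ j"
    and meas: "\<And>n. W n \<in> borel_measurable M" "\<And>n. A n \<in> borel_measurable M"
        "\<And>n. S n \<in> borel_measurable M" "\<And>n. Y n \<in> measurable M (count_space UNIV)"
    and W_nonneg: "\<And>n. AE \<omega> in M. 0 \<le> W n \<omega>"
    and recursion: "\<And>n. AE \<omega> in M. W (Suc n) \<omega> = max 0 (a * W n \<omega> + S n \<omega> - A (Suc n) \<omega>)"
    and indep: "triple_indep_past M W A S Y" and law: "fgm_law M A S Y P \<theta> lam fS"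
    and lim: "\<And>s i. 0 \<le> Re s \<Longrightarrow> (\<lambda>n. partial_transform M (W n) (Y n) s i) \<longlonglongrightarrow> Z s $ i"
    and s: "0 \<le> Re s" and s1: "\<And>j. s \<noteq> of_real (lam j)" and s2: "\<And>j. s \<noteq> of_real (2 * lam j)"
  shows "Z s = U_mat P \<theta> lam fS s *v Z (of_real a * s) + K_vec P a \<theta> lam fS Z s"
proof -
  have "Z s $ j = (U_mat P \<theta> lam fS s *v Z (of_real a * s) + K_vec P a \<theta> lam fS Z s) $ j" for j
  proof -
    define L1 where "L1 = of_real (lam j) / (of_real (lam j) - s)"
    define L2 where "L2 = of_real (2 * lam j) / (of_real (2 * lam j) - s)"
    let ?f = "\<lambda>i. laplace (fS i)" and ?g = "\<lambda>i. laplace (g_of (fS i))"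
    let ?l = "complex_of_real (lam j)" and ?t = "complex_of_real \<theta>"
    let ?pt = "\<lambda>n r i. partial_transform M (W n) (Y n) r i"
    let ?R = "\<lambda>i x y z. of_real (P $ i $ j) * ((L1 * ?f i s + ?t * (L2 - L1) * ?g i s) * x
        + (1 - L1) * (?f i ?l - ?t * ?g i ?l) * y
        + ?t * (1 - L2) * ?g i (of_real (2 * lam j)) * z)"
    have "?pt (Suc n) s j = (\<Sum>i\<in>UNIV. ?R i (?pt n (of_real a * s) i)
        (?pt n (of_real (a * lam j)) i) (?pt n (of_real (2 * a * lam j)) i))" for n
      unfolding partial_transform_step[where W = W and A = A and S = S and Y = Y and a = a, OF M meas recursion s] L1_def L2_def
      by (intro sum.cong refl workload_step_on_event[where fS = fS, OF M \<theta> lam a fS P meas W_nonneg indep law s s1 s2])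
    moreover have "(\<lambda>n. \<Sum>i\<in>UNIV. ?R i (?pt n (of_real a * s) i)
        (?pt n (of_real (a * lam j)) i) (?pt n (of_real (2 * a * lam j)) i))
      \<longlonglongrightarrow> (\<Sum>i\<in>UNIV. ?R i (Z (of_real a * s) $ i) (Z (of_real (a * lam j)) $ i) (Z (of_real (2 * a * lam j)) $ i))"
      using a s less_imp_le[OF lam] by (intro tendsto_intros lim) auto
    ultimately have "(\<lambda>n. ?pt (Suc n) s j) \<longlonglongrightarrow>
        (\<Sum>i\<in>UNIV. ?R i (Z (of_real a * s) $ i) (Z (of_real (a * lam j)) $ i) (Z (of_real (2 * a * lam j)) $ i))"
      by simp
    then have Zs: "Z s $ j =
        (\<Sum>i\<in>UNIV. ?R i (Z (of_real a * s) $ i) (Z (of_real (a * lam j)) $ i) (Z (of_real (2 * a * lam j)) $ i))"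
      using LIMSEQ_Suc[OF lim[OF s]] by (intro LIMSEQ_unique)
    \<comment> \<open>It lets \<open>L_1\<close> be factored out of both coefficients, as in \<open>U_mat\<close>.\<close>
    have L12: "L2 - L1 = L1 * (1 - L2)"
    proof -
      have "?l - s \<noteq> 0" "2 * ?l - s \<noteq> 0" using s1[of j] s2[of j] by auto
      then show ?thesis by (simp add: L1_def L2_def divide_simps) (simp add: algebra_simps)
    qed
    have U: "(U_mat P \<theta> lam fS s *v Z (of_real a * s)) $ j
        = (\<Sum>i\<in>UNIV. of_real (P $ i $ j) * (L1 * (?f i s + ?t * (1 - L2) * ?g i s)) * Z (of_real a * s) $ i)"
      by (simp only: matrix_vector_mult_def vec_lambda_beta U_mat_nth L1_def L2_def)
    have K: "K_vec P a \<theta> lam fS Z s $ j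
        = (\<Sum>i\<in>UNIV. (1 - L1) * (of_real (P $ i $ j) * (?f i ?l - ?t * ?g i ?l) * Z (of_real (a * lam j)) $ i))
          + (\<Sum>i\<in>UNIV. (1 - L2) * (?t * (of_real (P $ i $ j) * ?g i (of_real (2 * lam j)) * Z (of_real (2 * a * lam j)) $ i)))"
      by (simp only: K_vec_nth v1_def v2_def vec_lambda_beta sum_distrib_left L1_def L2_def)
    show ?thesis
      unfolding Zs L12 vector_add_component U K sum.distrib[symmetric]
      by (intro sum.cong refl) algebra
  qed
  then show ?thesis by (simp add: vec_eq_iff)
qed

text \<open>
  The quantity equals \<open>- a ^ n s / (\<kappa> - a ^ n s)\<close>. The denominators converge to \<open>\<kappa> > 0\<close> and never
  vanish, hence their inverses are bounded, although the first few may be close to a pole.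
\<close>

lemma pole_factor_bound:
  fixes \<kappa> :: "'n::finite \<Rightarrow> real" and s :: complex
  assumes a: "0 < a" "a < 1" and \<kappa>: "\<And>j. 0 < \<kappa> j" and s: "\<And>n j. of_real (a ^ n) * s \<noteq> of_real (\<kappa> j)"
  shows "\<exists>D\<ge>0. \<forall>n j. norm (1 - of_real (\<kappa> j) / (of_real (\<kappa> j) - of_real (a ^ n) * s)) \<le> D * a ^ n"
proof -
  have "\<exists>B>0. \<forall>n. norm (inverse (of_real (\<kappa> j) - of_real (a ^ n) * s)) \<le> B" for j
  proof -
    have "(\<lambda>n. of_real (\<kappa> j) - of_real (a ^ n) * s) \<longlonglongrightarrow> of_real (\<kappa> j) - of_real 0 * s"
      using a by (intro tendsto_intros LIMSEQ_power_zero) auto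
    then have "(\<lambda>n. inverse (of_real (\<kappa> j) - of_real (a ^ n) * s)) \<longlonglongrightarrow> inverse (of_real (\<kappa> j) - of_real 0 * s)"
      using \<kappa>[of j] by (intro tendsto_inverse) auto
    then show ?thesis
      by (intro Bseq_def[THEN iffD1] convergent_imp_Bseq convergentI)
  qed
  then obtain B where B: "\<And>j. 0 < B j" "\<And>n j. norm (inverse (of_real (\<kappa> j) - of_real (a ^ n) * s)) \<le> B j"
    by metis
  have "norm (1 - of_real (\<kappa> j) / (of_real (\<kappa> j) - of_real (a ^ n) * s)) \<le> (norm s * (\<Sum>j\<in>UNIV. B j)) * a ^ n" for n j
  proof -
    let ?d = "of_real (\<kappa> j) - of_real (a ^ n) * s"
    have "?d \<noteq> 0" using s[of n j] by (simp only: right_minus_eq)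
    then have "1 - of_real (\<kappa> j) / ?d = - (of_real (a ^ n) * s) * inverse ?d"
      by (simp add: divide_simps)
    then have "norm (1 - of_real (\<kappa> j) / ?d) = (a ^ n * norm s) * norm (inverse ?d)"
      using a by (simp add: norm_mult norm_power del: norm_inverse)
    also have "\<dots> \<le> (a ^ n * norm s) * (\<Sum>j\<in>UNIV. B j)"
    proof (intro mult_left_mono)
      have "B j \<le> (\<Sum>j\<in>UNIV. B j)"
        using B(1) by (intro member_le_sum) (auto intro: less_imp_le)
      with B(2)[of j n] show "norm (inverse ?d) \<le> (\<Sum>j\<in>UNIV. B j)" by linarith
    qed (use a in simp)
    finally show ?thesis by (simp add: mult_ac)
  qed
  moreover have "0 \<le> norm s * (\<Sum>j\<in>UNIV. B j)"
    using B(1) by (intro mult_nonneg_nonneg sum_nonneg) (auto intro: less_imp_le)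
  ultimately show ?thesis by blast
qed

text \<open>
  Near \<open>s = 0\<close> the matrix is a perturbation of \<open>P\<close> transposed. No rate at which the Laplace
  transforms approach 1 is available, as the service times may have infinite mean; that these
  transforms have modulus at most 1 suffices.
\<close>

lemma U_mat_norm_le:
  assumes \<theta>: "-1 \<le> \<theta>" "\<theta> \<le> 1" and f: "density_on_nonneg (fS i)" and P: "0 \<le> P $ i $ j"
    and s: "0 \<le> Re s"
    and L1: "norm (1 - of_real (lam j) / (of_real (lam j) - s)) \<le> c"
    and L2: "norm (1 - of_real (2 * lam j) / (of_real (2 * lam j) - s)) \<le> c"
  shows "norm (U_mat P \<theta> lam fS s $ j $ i) \<le> P $ i $ j * exp (2 * c)"
proof -
  let ?L1 = "of_real (lam j) / (of_real (lam j) - s)"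
  let ?L2 = "of_real (2 * lam j) / (of_real (2 * lam j) - s)"
  have c: "0 \<le> c" using norm_ge_zero L1 by (rule order_trans)
  have 1: "norm ?L1 \<le> 1 + c"
    using norm_triangle_sub[of ?L1 1] L1 by (simp add: norm_minus_commute)
  have "norm (of_real \<theta> * (1 - ?L2) * laplace (g_of (fS i)) s) \<le> 1 * c * 1"
    unfolding norm_mult using \<theta> c
    by (intro mult_mono L2 norm_laplace_le_1[OF f s]) auto
  then have 2: "norm (laplace (fS i) s + of_real \<theta> * (1 - ?L2) * laplace (g_of (fS i)) s) \<le> 1 + c"
    using norm_laplace_le_1(1)[OF f s] by (intro norm_triangle_le) simp
  have "norm (U_mat P \<theta> lam fS s $ j $ i) \<le> P $ i $ j * ((1 + c) * (1 + c))"
    unfolding U_mat_nth norm_mult[of "of_real (P $ i $ j)"] norm_mult[of ?L1] using P c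
    by (intro mult_mono 1 2) auto
  also have "\<dots> \<le> P $ i $ j * (exp c * exp c)"
    using P c by (intro mult_left_mono mult_mono exp_ge_add_one_self) auto
  finally show ?thesis by (simp add: exp_add[symmetric])
qed

lemma partial_transform_tendsto:
  fixes W :: "'v \<Rightarrow> real" and Y :: "'v \<Rightarrow> 'n::finite"
  assumes M: "prob_space M" and [measurable]: "W \<in> borel_measurable M" and Y: "Y \<in> measurable M (count_space UNIV)"
    and W: "AE \<omega> in M. 0 \<le> W \<omega>" and r: "\<And>n. 0 \<le> Re (r n)" "r \<longlonglongrightarrow> r0"
  shows "(\<lambda>n. partial_transform M W Y (r n) i) \<longlonglongrightarrow> partial_transform M W Y r0 i"
  unfolding partial_transform_def
proof (rule integral_dominated_convergence)
  interpret prob_space M by fact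
  note [measurable] = pred_state_eq[OF Y]
  show "integrable M (\<lambda>_. 1 :: real)" by simp
  show "(\<lambda>\<omega>. exp (- r0 * complex_of_real (W \<omega>)) * of_bool (Y \<omega> = i)) \<in> borel_measurable M"
    "(\<lambda>\<omega>. exp (- r n * complex_of_real (W \<omega>)) * of_bool (Y \<omega> = i)) \<in> borel_measurable M" for n
    by measurable
  show "AE \<omega> in M. (\<lambda>n. exp (- r n * complex_of_real (W \<omega>)) * of_bool (Y \<omega> = i))
      \<longlonglongrightarrow> exp (- r0 * complex_of_real (W \<omega>)) * of_bool (Y \<omega> = i)"
    by (intro AE_I2 tendsto_intros r)
  show "AE \<omega> in M. norm (exp (- r n * complex_of_real (W \<omega>)) * of_bool (Y \<omega> = i)) \<le> 1" for n
    using W by eventually_elim (use r in \<open>auto simp: norm_mult\<close>)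
qed

theorem mainTheorem7:
  fixes M :: "'w measure" and M' :: "'v measure"
    and W A S :: "nat \<Rightarrow> 'w \<Rightarrow> real" and Y :: "nat \<Rightarrow> 'w \<Rightarrow> 'n::finite"
    and W' :: "'v \<Rightarrow> real" and Y' :: "'v \<Rightarrow> 'n"
    and P :: "real ^ 'n ^ 'n" and \<pi> :: "real ^ 'n"
    and a \<theta> :: real and lam :: "'n \<Rightarrow> real" and fS :: "'n \<Rightarrow> real \<Rightarrow> real"
    and Z :: "complex \<Rightarrow> complex ^ 'n"
  assumes "0 < a" "a < 1" "-1 \<le> \<theta>" "\<theta> \<le> 1"
    and "\<And>j. 0 < lam j" "\<And>i. density_on_nonneg (fS i)"
    and "stochastic_matrix P" "irreducible_matrix P" "stationary_distribution P \<pi>"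
    and "prob_space M" "markov_chain M Y P"
    and "\<And>n. W n \<in> borel_measurable M" "\<And>n. A n \<in> borel_measurable M"
        "\<And>n. S n \<in> borel_measurable M"
    and "\<And>n. AE \<omega> in M. 0 \<le> W n \<omega>"
    and "\<And>n. AE \<omega> in M. W (Suc n) \<omega> = max 0 (a * W n \<omega> + S n \<omega> - A (Suc n) \<omega>)"
    and "triple_indep_past M W A S Y" "fgm_law M A S Y P \<theta> lam fS"
    and "\<And>s i. 0 \<le> Re s \<Longrightarrow> (\<lambda>n. partial_transform M (W n) (Y n) s i) \<longlonglongrightarrow> Z s $ i"
    and "prob_space M'" "W' \<in> borel_measurable M'" "Y' \<in> measurable M' (count_space UNIV)"
    and "AE \<omega> in M'. 0 \<le> W' \<omega>" "\<And>i. \<P>(\<omega> in M'. Y' \<omega> = i) = \<pi> $ i"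
    and "\<And>s i. 0 \<le> Re s \<Longrightarrow> Z s $ i = partial_transform M' W' Y' s i"
  shows "(\<forall>s. 0 \<le> Re s \<longrightarrow>
            (\<forall>n k. of_real (a ^ n) * s \<notin> {of_real (lam k), of_real (2 * lam k)}) \<longrightarrow>
            summable (\<lambda>n. mat_prod (\<lambda>d. U_mat P \<theta> lam fS (of_real (a ^ d) * s)) n *v
                            K_vec P a \<theta> lam fS Z (of_real (a ^ n) * s)) \<and>
            convergent (\<lambda>n. mat_prod (\<lambda>m. U_mat P \<theta> lam fS (of_real (a ^ m) * s)) (Suc n) *v
                              cvec \<pi>) \<and>
            Z s = (\<Sum>n. mat_prod (\<lambda>d. U_mat P \<theta> lam fS (of_real (a ^ d) * s)) n *v
                          K_vec P a \<theta> lam fS Z (of_real (a ^ n) * s)) +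
                  lim (\<lambda>n. mat_prod (\<lambda>m. U_mat P \<theta> lam fS (of_real (a ^ m) * s)) (Suc n) *v
                             cvec \<pi>)) \<and>
         Z 0 = cvec \<pi>"
proof (intro conjI allI impI)
  note a = assms(1,2) and \<theta> = assms(3,4) and lam = assms(5) and fS = assms(6)
  have P: "\<And>i j. 0 \<le> P $ i $ j" and rows: "\<And>i. (\<Sum>j\<in>UNIV. P $ i $ j) = 1"
    using assms(7) by (auto simp: stochastic_matrix_def)
  have Y: "\<And>n. Y n \<in> measurable M (count_space UNIV)"
    using assms(11) by (simp add: markov_chain_def)
  interpret M': prob_space M' by fact
  show Z0: "Z 0 = cvec \<pi>"
  proof -
    have "Z 0 $ i = cvec \<pi> $ i" for i
    proof -
      have "Z 0 $ i = partial_transform M' W' Y' 0 i" by (rule assms(25)) simp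
      also have "\<dots> = (\<integral>\<omega>. of_real (indicator {\<omega>\<in>space M'. Y' \<omega> = i} \<omega>) \<partial>M')"
        unfolding partial_transform_def by (intro Bochner_Integration.integral_cong) (auto simp: indicator_def)
      also have "\<dots> = of_real (\<integral>\<omega>. indicator {\<omega>\<in>space M'. Y' \<omega> = i} \<omega> \<partial>M')"
        by (rule integral_complex_of_real)
      also have "\<dots> = of_real (measure M' {\<omega>\<in>space M'. Y' \<omega> = i})"
        using pred_state_eq[OF assms(22)] by (simp add: pred_def)
      finally show ?thesis by (simp add: assms(24) cvec_def)
    qed
    then show ?thesis by (simp add: vec_eq_iff)
  qed
  fix s :: complex
  assume s: "0 \<le> Re s"
    and poles: "\<forall>n k. of_real (a ^ n) * s \<notin> {of_real (lam k), of_real (2 * lam k)}"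
  let ?U = "\<lambda>d. U_mat P \<theta> lam fS (of_real (a ^ d) * s)"
  let ?K = "\<lambda>n. K_vec P a \<theta> lam fS Z (of_real (a ^ n) * s)"
  let ?z = "\<lambda>n. Z (of_real (a ^ n) * s)"
  have Re_s: "0 \<le> Re (of_real (a ^ n) * s)" for n
    using s a by simp
  have n1: "of_real (a ^ n) * s \<noteq> of_real (lam j)" and n2: "of_real (a ^ n) * s \<noteq> of_real (2 * lam j)" for n j
    using poles by auto
  have rec: "?z n = ?U n *v ?z (Suc n) + ?K n" for n
    using transform_equation[OF assms(10) \<theta> a(1) lam fS P assms(12,13,14) Y assms(15,16,17,18,19)
        Re_s[of n] n1 n2]
    by (simp add: mult.assoc)
  obtain D1 where D1: "0 \<le> D1"
      "\<And>n j. norm (1 - of_real (lam j) / (of_real (lam j) - of_real (a ^ n) * s)) \<le> D1 * a ^ n"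
    using pole_factor_bound[of a lam s, OF a lam n1] by blast
  obtain D2 where D2: "0 \<le> D2"
      "\<And>n j. norm (1 - of_real (2 * lam j) / (of_real (2 * lam j) - of_real (a ^ n) * s)) \<le> D2 * a ^ n"
    using pole_factor_bound[of a "\<lambda>j. 2 * lam j" s] a lam n2 by (metis mult_pos_pos zero_less_numeral)
  define D where "D = D1 + D2"
  have D: "0 \<le> D" using D1 D2 by (simp add: D_def)
  have bD1: "norm (1 - of_real (lam j) / (of_real (lam j) - of_real (a ^ n) * s)) \<le> D * a ^ n"
    and bD2: "norm (1 - of_real (2 * lam j) / (of_real (2 * lam j) - of_real (a ^ n) * s)) \<le> D * a ^ n" for n j
    using D1(2)[of j n] D2(2)[of j n] D1(1) D2(1) a
    by (auto simp: D_def distrib_right intro: order_trans)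
  have bound: "norm (mat_prod ?U n *v v) \<le> (exp (2 * D / (1 - a)) * real CARD('n)) * norm v" for n v
  proof (rule norm_mat_prod_le[OF rows])
    show "norm (?U m $ j $ i) \<le> P $ i $ j * exp (2 * (D * a ^ m))" for m i j
      by (rule U_mat_norm_le[OF \<theta> fS P Re_s bD1 bD2])
    show "(\<Sum>m<n. 2 * (D * a ^ m)) \<le> 2 * D / (1 - a)" for n
    proof -
      have "(\<Sum>m<n. a ^ m) \<le> (\<Sum>m. a ^ m)"
        using a by (intro sum_le_suminf) (auto intro: summable_geometric)
      also have "\<dots> = 1 / (1 - a)" using a by (intro suminf_geometric) simp
      finally have "2 * D * (\<Sum>m<n. a ^ m) \<le> 2 * D * (1 / (1 - a))"
        using D by (intro mult_left_mono) auto
      then show ?thesis by (simp add: sum_distrib_left mult.assoc)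
    qed
  qed
  have sum_K: "summable (\<lambda>n. norm (?K n))"
  proof (rule summable_comparison_test')
    let ?v = "\<lambda>j. norm (v1 P a \<theta> lam fS Z $ j) + norm (v2 P a \<theta> lam fS Z $ j)"
    show "summable (\<lambda>n. D * (\<Sum>j\<in>UNIV. ?v j) * a ^ n)"
      using a by (intro summable_mult summable_geometric) simp
    show "norm (norm (?K n)) \<le> D * (\<Sum>j\<in>UNIV. ?v j) * a ^ n" for n
    proof -
      have "norm (?K n $ j) \<le> D * a ^ n * ?v j" for j
      proof -
        have "norm (?K n $ j) \<le> (D * a ^ n) * norm (v1 P a \<theta> lam fS Z $ j) + (D * a ^ n) * norm (v2 P a \<theta> lam fS Z $ j)"
          unfolding K_vec_nth
          by (rule norm_triangle_le, unfold norm_mult) (intro add_mono mult_right_mono bD1 bD2 norm_ge_zero)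
        then show ?thesis by (simp add: distrib_left)
      qed
      then have "(\<Sum>j\<in>UNIV. norm (?K n $ j)) \<le> (\<Sum>j\<in>UNIV. D * a ^ n * ?v j)"
        by (rule sum_mono)
      moreover have "norm (?K n) \<le> (\<Sum>j\<in>UNIV. norm (?K n $ j))"
        unfolding norm_vec_def by (rule L2_set_le_sum) simp
      ultimately show ?thesis by (simp add: sum_distrib_left[symmetric] mult_ac)
    qed
  qed
  have lim_z: "?z \<longlonglongrightarrow> cvec \<pi>"
  proof (rule vec_tendstoI)
    fix i
    have "(\<lambda>n. of_real (a ^ n) * s) \<longlonglongrightarrow> of_real 0 * s"
      using a by (intro tendsto_intros LIMSEQ_power_zero) auto
    then have "(\<lambda>n. partial_transform M' W' Y' (of_real (a ^ n) * s) i) \<longlonglongrightarrow> partial_transform M' W' Y' 0 i"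
      by (intro partial_transform_tendsto assms Re_s) simp
    then show "(\<lambda>n. ?z n $ i) \<longlonglongrightarrow> cvec \<pi> $ i"
      unfolding Z0[symmetric] assms(25)[OF Re_s] by (simp add: assms(25))
  qed
  note solution = linear_recursion_solution[where U = ?U and k = ?K and z = ?z, OF rec bound sum_K lim_z]
  show "summable (\<lambda>n. mat_prod ?U n *v ?K n)"
    by (rule solution)
  show "convergent (\<lambda>n. mat_prod ?U (Suc n) *v cvec \<pi>)"
    by (rule solution)
  show "Z s = (\<Sum>n. mat_prod ?U n *v ?K n) + lim (\<lambda>n. mat_prod ?U (Suc n) *v cvec \<pi>)"
    using solution(3) by simp
qed

end
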